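(* Let $n\geq 3$ and $m\geq 2$ be integers, and let $f_1,\ldots,f_m\in R=\mathbb{K}[x_1,\ldots,x_n]$ be nearly transversal forms of respective degrees $d_1,\ldots,d_m\geq 2$, where $\mathbb{K}$ is an infinite field whose characteristic is zero or does not divide any of the sums $\sum_{i\in S}d_i$ with $\emptyset\neq S\subseteq\{1,\ldots,m\}$. Set $F=f_1\cdots f_m$. Then $${\rm indeg}(\mathrm{Syz}(J_F))\geq \left\lfloor \frac{d_1+\cdots+d_m}{m}\right\rfloor-1.$$
   Context: Put $c=\min\{m,n\}$. Forms $f_1,\ldots,f_m$ are nearly transversal if: (a) for every $1\leq i\leq m$, the hypersurface $\mathrm{Proj}(R/(f_i))$ is smooth (in particular $f_i$ is irreducible and $J_{f_i}$ is a complete intersection of codimension $n$); and (b) the Jacobian matrix of any subset $S_c\subset\{f_1,\ldots,f_m\}$ with $c$ elements has maximal rank modulo every prime ideal of height $n-1$ containing $S_c$. In particular $\gcd(f_i,f_j)=1$ for $i\neq j$. For a form $h\in R$, $J_h$ is the ideal generated by its partial derivatives $h_{x_1},\ldots,h_{x_n}$, and $\mathrm{Syz}(J_h)=\{(P_1,\ldots,P_n)\in R^n:\sum_iP_ih_{x_i}=0\}$, graded so that $(P_1,\ldots,P_n)$ has degree $r$ if all $P_i$ are forms of degree $r$ (or zero); ${\rm indeg}$ denotes the least degree in which this graded module is nonzero. *)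

theory Defs
  imports
    "HOL-Library.Poly_Mapping"
    "HOL-Library.Cardinality"
    "HOL-Library.Extended_Nat"
    "HOL-Algebra.Ideal"
    "HOL-Algebra.Algebraic_Closure_Type"
begin

text \<open>The polynomial ring \<open>R = K[x\<^sub>1, \<dots>, x\<^sub>n]\<close> is the monoid algebra over \<open>'k\<close> of the exponent
  vectors \<open>'n \<Rightarrow>\<^sub>0 nat\<close>; the variables are indexed by a finite type \<open>'n\<close>, and \<open>n = CARD('n)\<close>.\<close>

type_synonym ('n, 'k) mpol = "('n \<Rightarrow>\<^sub>0 nat) \<Rightarrow>\<^sub>0 'k"

definition var :: "'n \<Rightarrow> ('n, 'k::comm_ring_1) mpol" where
  "var j = Poly_Mapping.single (Poly_Mapping.single j 1) 1"

definition pdiff :: "'n \<Rightarrow> ('n, 'k::comm_ring_1) mpol \<Rightarrow> ('n, 'k) mpol" where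
  "pdiff j p = (\<Sum>t\<in>Poly_Mapping.keys p.
     Poly_Mapping.single (t - Poly_Mapping.single j 1)
       (of_nat (Poly_Mapping.lookup t j) * Poly_Mapping.lookup p t))"

definition mon_degree :: "('n::finite \<Rightarrow>\<^sub>0 nat) \<Rightarrow> nat" where
  "mon_degree t = (\<Sum>j\<in>UNIV. Poly_Mapping.lookup t j)"

text \<open>The zero polynomial is \<open>homogeneous\<close> of every degree, but it is not a \<open>form\<close>.\<close>

definition homogeneous :: "nat \<Rightarrow> ('n::finite, 'k::comm_ring_1) mpol \<Rightarrow> bool" where
  "homogeneous r p \<longleftrightarrow> (\<forall>t\<in>Poly_Mapping.keys p. mon_degree t = r)"

definition form :: "nat \<Rightarrow> ('n::finite, 'k::comm_ring_1) mpol \<Rightarrow> bool" where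
  "form r p \<longleftrightarrow> p \<noteq> 0 \<and> homogeneous r p"

definition hom_component :: "nat \<Rightarrow> ('n::finite, 'k::comm_ring_1) mpol \<Rightarrow> ('n, 'k) mpol" where
  "hom_component r p = (\<Sum>t\<in>{t\<in>Poly_Mapping.keys p. mon_degree t = r}.
     Poly_Mapping.single t (Poly_Mapping.lookup p t))"

definition prime_ideal :: "'a::comm_ring_1 set \<Rightarrow> bool" where
  "prime_ideal P \<longleftrightarrow> primeideal P (ring_of_type_algebra :: 'a ring)"

definition height :: "'a::comm_ring_1 set \<Rightarrow> enat" where
  "height P = Sup (enat ` {k. \<exists>C. (\<forall>i\<le>k. prime_ideal (C i)) \<and> (\<forall>i<k. C i \<subset> C (Suc i)) \<and> C k = P})"

definition homogeneous_ideal :: "('n::finite, 'k::comm_ring_1) mpol set \<Rightarrow> bool" where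
  "homogeneous_ideal P \<longleftrightarrow> (\<forall>p\<in>P. \<forall>r. hom_component r p \<in> P)"

text \<open>The points of \<open>Proj (R/(g))\<close>, as homogeneous primes of \<open>R\<close> that contain \<open>g\<close> and do not contain
  the irrelevant ideal \<open>(x\<^sub>1, \<dots>, x\<^sub>n)\<close>.\<close>

definition Proj_hypersurface :: "('n::finite, 'k::comm_ring_1) mpol \<Rightarrow> ('n, 'k) mpol set set" where
  "Proj_hypersurface g =
     {P. prime_ideal P \<and> homogeneous_ideal P \<and> g \<in> P \<and> \<not> (\<forall>j. var j \<in> P)}"

text \<open>Rank, over the fraction field of \<open>R/P\<close>, of the matrix with rows \<open>M i\<close> (\<open>i \<in> I\<close>, \<open>I\<close> finite): the
  maximal number of linearly independent rows. Clearing denominators, independence over the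
  fraction field is independence over the domain \<open>R/P\<close>.\<close>

definition rows_independent_mod :: "'a::comm_ring_1 set \<Rightarrow> 'i set \<Rightarrow> ('i \<Rightarrow> 'n \<Rightarrow> 'a) \<Rightarrow> bool" where
  "rows_independent_mod P I M \<longleftrightarrow>
     (\<forall>a. (\<forall>j. (\<Sum>i\<in>I. a i * M i j) \<in> P) \<longrightarrow> (\<forall>i\<in>I. a i \<in> P))"

definition rank_mod :: "'a::comm_ring_1 set \<Rightarrow> 'i set \<Rightarrow> ('i \<Rightarrow> 'n \<Rightarrow> 'a) \<Rightarrow> nat" where
  "rank_mod P I M = Max (card ` {T. T \<subseteq> I \<and> rows_independent_mod P T M})"

definition jacobian :: "('i \<Rightarrow> ('n, 'k::comm_ring_1) mpol) \<Rightarrow> 'i \<Rightarrow> 'n \<Rightarrow> ('n, 'k) mpol" where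
  "jacobian f i j = pdiff j (f i)"

text \<open>Smoothness over \<open>'k\<close> of the scheme \<open>Proj (R/(g))\<close>: at each of its points, closed or not, the
  Jacobian matrix has rank equal to the codimension \<open>1\<close>. Homogeneous coordinates give the same
  condition as the affine charts \<open>x\<^sub>j \<noteq> 0\<close> by Euler's relation \<open>\<Sum>\<^sub>j x\<^sub>j g\<^bsub>x\<^sub>j\<^esub> = deg(g) g\<close>.\<close>

definition smooth_hypersurface :: "('n::finite, 'k::comm_ring_1) mpol \<Rightarrow> bool" where
  "smooth_hypersurface g \<longleftrightarrow>
     (\<forall>P\<in>Proj_hypersurface g. rank_mod P {()} (jacobian (\<lambda>_. g)) = 1)"

text \<open>The forms are a family indexed by \<open>{1..m}\<close>, and subfamilies are given by sets of indices (so
  that \<open>f\<^sub>i = f\<^sub>j\<close> with \<open>i \<noteq> j\<close> counts as two elements).\<close>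

definition nearly_transversal :: "nat \<Rightarrow> (nat \<Rightarrow> ('n::finite, 'k::comm_ring_1) mpol) \<Rightarrow> bool" where
  "nearly_transversal m f \<longleftrightarrow>
     (\<forall>i\<in>{1..m}. smooth_hypersurface (f i)) \<and>
     (\<forall>I\<subseteq>{1..m}. card I = min m CARD('n) \<longrightarrow>
        (\<forall>P. prime_ideal P \<and> height P = enat (CARD('n) - 1) \<and> f ` I \<subseteq> P \<longrightarrow>
           rank_mod P I (jacobian f) = min (card I) CARD('n)))"

definition Syz_J :: "('n::finite, 'k::comm_ring_1) mpol \<Rightarrow> ('n \<Rightarrow> ('n, 'k) mpol) set" where
  "Syz_J h = {P. (\<Sum>j\<in>UNIV. P j * pdiff j h) = 0}"

text \<open>For a graded submodule \<open>M\<close> of \<open>R\<^sup>n\<close>; the value is \<open>\<infinity>\<close> if \<open>M = 0\<close>.\<close>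

definition indeg :: "('n::finite \<Rightarrow> ('n, 'k::comm_ring_1) mpol) set \<Rightarrow> enat" where
  "indeg M = Inf (enat ` {r. \<exists>P\<in>M. (\<exists>j. P j \<noteq> 0) \<and> (\<forall>j. homogeneous r (P j))})"

end

theory Submission
  imports "HOL-Computational_Algebra.Polynomial" Defs
begin

text \<open>
  Write \<open>F = \<Prod>f\<^sub>i\<close>, choose \<open>f = f\<^sub>i\<close> of the largest degree \<open>d\<close>, and read a syzygy \<open>P\<close> of degree \<open>r\<close> of
  the partials of \<open>F\<close> as the derivation \<open>\<theta> = \<Sum>P\<^sub>j \<partial>\<^sub>j\<close>, which kills \<open>F\<close>. It turns out that \<open>r < d - 1\<close>
  forces \<open>P = 0\<close>; since \<open>d\<close> is at least the average degree, the claim follows.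

  Suppose \<open>f\<close> is prime and \<open>F = f\<^sup>k C\<close> with \<open>f\<close> not dividing \<open>C\<close>. Then \<open>\<theta>(F) = 0\<close> gives that \<open>f\<close> divides
  \<open>k \<theta>(f) C\<close>. The factors divisible by \<open>f\<close> are constant multiples of it because \<open>d\<close> is maximal, so
  \<open>k d\<close> is a sum of some of the \<open>d\<^sub>j\<close>, and the assumption on the characteristic makes \<open>k\<close> invertible.
  Hence \<open>\<theta>(f) = g f\<close>. By Euler's relation \<open>d P\<^sub>j - g x\<^sub>j\<close> is then a syzygy of degree \<open>r\<close> of the
  partials of \<open>f\<close>. These form a regular sequence of forms of degree \<open>d - 1\<close>, whose syzygies have degree
  at least \<open>d - 1\<close>, so \<open>d P\<^sub>j = g x\<^sub>j\<close>. Applying both sides to \<open>F\<close> gives \<open>0 = g (\<Sum>d\<^sub>j) F\<close>, so \<open>g = 0\<close>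
  and \<open>P = 0\<close> (\<open>syzygy_degree_bound\<close>).

  Two facts carry this argument. The first is that the partials of a smooth form are a regular
  sequence. Smoothness and Euler's relation say that no homogeneous prime except the irrelevant one
  contains all the partials, so the ideal of the partials contains powers of all variables
  (\<open>smooth_imp_partials_contain_var_powers\<close>). That \<open>n\<close> forms \<open>g\<^sub>j\<close> with this property in \<open>n\<close> variables
  are a regular sequence (\<open>regular_family_if_contains_var_powers\<close>) is proved without homological
  algebra. Pure powers \<open>x\<^sub>j\<^sup>e\<close> are visibly regular, and regularity survives the exchange of one member
  of the family as long as the new family still generates an ideal with powers of all variables
  (\<open>regular_family_exchange\<close>). To get from the pure powers to the \<open>g\<^sub>j\<close> by such exchanges one passes
  through powers of general linear forms; that general forms exist is a bound on the number of
  points of a zero-dimensional projective scheme (\<open>generic_form_keeps_contains_var_powers\<close>).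

  The second is that a smooth form \<open>f\<close> is prime. If \<open>f = a b\<close> with both degrees positive, then \<open>a\<close> and \<open>b\<close>
  generate an ideal containing the partials, hence powers of all \<open>n \<ge> 3\<close> variables, and powers of \<open>a\<close>
  and \<open>b\<close>, one of them repeated, would be a regular sequence, which is absurd
  (\<open>total_degree_zero_or\<close>). So \<open>f\<close> is irreducible, and it is prime because \<open>K[x\<^sub>1, \<dots>, x\<^sub>n]\<close> is factorial,
  which is Gauss's lemma applied to one variable at a time (\<open>factorial_polys_over\<close>,
  \<open>irreducible_imp_prime\<close>).
\<close>

section \<open>Gauss's lemma\<close>

text \<open>The variables are adjoined one at a time, and the intermediate rings \<open>K[x\<^sub>j : j \<in> V]\<close> are subsets
  of a single type. Hence subrings are sets here, and divisibility and primality are relative to them.\<close>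

definition subring_set :: "'a::comm_ring_1 set \<Rightarrow> bool" where
  "subring_set D \<longleftrightarrow> 1 \<in> D \<and> (\<forall>a\<in>D. \<forall>b\<in>D. a - b \<in> D \<and> a * b \<in> D)"

definition dvd_in :: "'a::comm_ring_1 set \<Rightarrow> 'a \<Rightarrow> 'a \<Rightarrow> bool" where
  "dvd_in D a b \<longleftrightarrow> (\<exists>c\<in>D. b = a * c)"

text \<open>Units are admitted: a product of primes and units then needs no separate unit factor, and the
  removal of constant factors below treats both alike.\<close>

definition prime_or_unit :: "'a::comm_ring_1 set \<Rightarrow> 'a \<Rightarrow> bool" where
  "prime_or_unit D p \<longleftrightarrow> p \<in> D \<and> p \<noteq> 0 \<and>
     (\<forall>a\<in>D. \<forall>b\<in>D. dvd_in D p (a * b) \<longrightarrow> dvd_in D p a \<or> dvd_in D p b)"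

lemma prime_or_unit_in: "prime_or_unit D p \<Longrightarrow> p \<in> D" "prime_or_unit D p \<Longrightarrow> p \<noteq> 0"
  unfolding prime_or_unit_def by blast+

lemma prime_or_unitD:
  "prime_or_unit D p \<Longrightarrow> a \<in> D \<Longrightarrow> b \<in> D \<Longrightarrow> dvd_in D p (a * b) \<Longrightarrow> dvd_in D p a \<or> dvd_in D p b"
  unfolding prime_or_unit_def by simp

inductive prime_product :: "'a::comm_ring_1 set \<Rightarrow> 'a \<Rightarrow> bool" for D where
  single: "prime_or_unit D p \<Longrightarrow> prime_product D p"
| mult: "prime_or_unit D p \<Longrightarrow> prime_product D q \<Longrightarrow> prime_product D (p * q)"

definition factorial_set :: "'a::comm_ring_1 set \<Rightarrow> bool" where
  "factorial_set D \<longleftrightarrow> (\<forall>a\<in>D. a \<noteq> 0 \<longrightarrow> prime_product D a)"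

definition polys_over :: "'a::comm_ring_1 set \<Rightarrow> 'a poly set" where
  "polys_over D = {q. \<forall>i. coeff q i \<in> D}"

lemma subring_setD:
  assumes "subring_set D"
  shows "1 \<in> D" "0 \<in> D" "a \<in> D \<Longrightarrow> b \<in> D \<Longrightarrow> a - b \<in> D" "a \<in> D \<Longrightarrow> b \<in> D \<Longrightarrow> a * b \<in> D"
    "a \<in> D \<Longrightarrow> b \<in> D \<Longrightarrow> a + b \<in> D" "a \<in> D \<Longrightarrow> - a \<in> D"
proof -
  have 1: "\<And>a b. a \<in> D \<Longrightarrow> b \<in> D \<Longrightarrow> a - b \<in> D" "1 \<in> D"
    "\<And>a b. a \<in> D \<Longrightarrow> b \<in> D \<Longrightarrow> a * b \<in> D"
    using assms by (auto simp: subring_set_def)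
  have 0: "0 \<in> D" using 1(1)[OF 1(2) 1(2)] by simp
  have m: "\<And>a. a \<in> D \<Longrightarrow> - a \<in> D" using 1(1)[OF 0] by simp
  show "1 \<in> D" "0 \<in> D" "a \<in> D \<Longrightarrow> b \<in> D \<Longrightarrow> a - b \<in> D" "a \<in> D \<Longrightarrow> b \<in> D \<Longrightarrow> a * b \<in> D"
    "a \<in> D \<Longrightarrow> - a \<in> D" using 0 1 m by auto
  show "a \<in> D \<Longrightarrow> b \<in> D \<Longrightarrow> a + b \<in> D" using 1(1)[of a "- b"] m by simp
qed

lemma subring_set_sum: "subring_set D \<Longrightarrow> (\<And>i. i \<in> I \<Longrightarrow> g i \<in> D) \<Longrightarrow> (\<Sum>i\<in>I. g i) \<in> D"
  by (induction I rule: infinite_finite_induct) (auto intro: subring_setD)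

lemma dvd_in_mult: "subring_set D \<Longrightarrow> dvd_in D p a \<Longrightarrow> b \<in> D \<Longrightarrow> dvd_in D p (a * b)"
  unfolding dvd_in_def by (metis mult.assoc subring_setD(4))

lemma dvd_in_diff: "subring_set D \<Longrightarrow> dvd_in D p a \<Longrightarrow> dvd_in D p b \<Longrightarrow> dvd_in D p (a - b)"
  unfolding dvd_in_def by (metis right_diff_distrib subring_setD(3))

lemma dvd_in_sum:
  "subring_set D \<Longrightarrow> (\<And>i. i \<in> I \<Longrightarrow> dvd_in D p (g i)) \<Longrightarrow> dvd_in D p (\<Sum>i\<in>I. g i)"
proof (induction I rule: infinite_finite_induct)
  case (insert i I)
  then have "dvd_in D p (g i)" "dvd_in D p (sum g I)" by auto
  then show ?case using insert(1,2,4) unfolding dvd_in_def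
    by (metis distrib_left subring_setD(5) sum.insert)
qed (auto simp: dvd_in_def intro!: bexI[of _ 0] subring_setD)

lemma subring_polys_over:
  assumes "subring_set D"
  shows "subring_set (polys_over D)"
  unfolding subring_set_def polys_over_def
  using assms by (auto simp: coeff_mult coeff_1 intro!: subring_setD subring_set_sum)

lemma const_in_polys_over: "subring_set D \<Longrightarrow> c \<in> D \<Longrightarrow> [:c:] \<in> polys_over D"
  by (auto simp: polys_over_def coeff_pCons subring_setD split: nat.splits)

lemma monom_in_polys_over: "subring_set D \<Longrightarrow> c \<in> D \<Longrightarrow> monom c k \<in> polys_over D"
  by (auto simp: polys_over_def coeff_monom subring_setD)

lemma dvd_in_const_iff:
  assumes D: "subring_set D"
  shows "dvd_in (polys_over D) [:p:] a \<longleftrightarrow> (\<forall>i. dvd_in D p (coeff a i))"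
proof
  assume "dvd_in (polys_over D) [:p:] a"
  then show "\<forall>i. dvd_in D p (coeff a i)"
    unfolding dvd_in_def polys_over_def by (auto simp: coeff_smult)
next
  assume "\<forall>i. dvd_in D p (coeff a i)"
  then obtain c where c: "\<And>i. c i \<in> D" "\<And>i. coeff a i = p * c i"
    unfolding dvd_in_def by metis
  let ?q = "\<Sum>i\<le>degree a. monom (c i) i"
  have q: "coeff ?q k = (if k \<le> degree a then c k else 0)" for k
    by (simp add: coeff_sum coeff_monom)
  have "?q \<in> polys_over D" using q c D by (auto simp: polys_over_def subring_setD)
  moreover have "a = [:p:] * ?q"
  proof (rule poly_eqI)
    fix k show "coeff a k = coeff ([:p:] * ?q) k"
      using c(2)[of k] q[of k] by (cases "k \<le> degree a") (auto simp: coeff_eq_0)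
  qed
  ultimately show "dvd_in (polys_over D) [:p:] a" unfolding dvd_in_def by blast
qed

text \<open>If neither \<open>a\<close> nor \<open>b\<close> is divisible by \<open>p\<close>, take in each the first coefficient, at \<open>i\<close> and \<open>j\<close>, that
  is not. In the coefficient of \<open>a b\<close> at \<open>i + j\<close> all terms but \<open>a\<^sub>i b\<^sub>j\<close> are divisible by \<open>p\<close>.\<close>

lemma prime_or_unit_const:
  assumes D: "subring_set D" and p: "prime_or_unit D p"
  shows "prime_or_unit (polys_over D) [:p:]"
  unfolding prime_or_unit_def
proof (intro conjI ballI impI)
  show "[:p:] \<in> polys_over D" "[:p:] \<noteq> 0"
    using prime_or_unit_in[OF p] const_in_polys_over[OF D] by simp_all
  fix a b assume ab: "a \<in> polys_over D" "b \<in> polys_over D" "dvd_in (polys_over D) [:p:] (a * b)"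
  show "dvd_in (polys_over D) [:p:] a \<or> dvd_in (polys_over D) [:p:] b"
  proof (rule ccontr)
    assume "\<not> ?thesis"
    then have ex: "\<exists>i. \<not> dvd_in D p (coeff a i)" "\<exists>i. \<not> dvd_in D p (coeff b i)"
      unfolding dvd_in_const_iff[OF D] by simp_all
    define i where "i = (LEAST i. \<not> dvd_in D p (coeff a i))"
    define j where "j = (LEAST i. \<not> dvd_in D p (coeff b i))"
    have i: "\<not> dvd_in D p (coeff a i)" "\<And>k. k < i \<Longrightarrow> dvd_in D p (coeff a k)"
      unfolding i_def using LeastI_ex[OF ex(1)] by (simp, metis (lifting) not_less_Least)
    have j: "\<not> dvd_in D p (coeff b j)" "\<And>k. k < j \<Longrightarrow> dvd_in D p (coeff b k)"
      unfolding j_def using LeastI_ex[OF ex(2)] by (simp, metis (lifting) not_less_Least)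
    let ?f = "\<lambda>k. coeff a k * coeff b (i + j - k)"
    have "coeff (a * b) (i + j) = ?f i + (\<Sum>k\<in>{..i+j}-{i}. ?f k)"
      unfolding coeff_mult by (rule sum.remove) auto
    then have split: "?f i = coeff (a * b) (i + j) - (\<Sum>k\<in>{..i+j}-{i}. ?f k)" by simp
    have "dvd_in D p (\<Sum>k\<in>{..i+j}-{i}. ?f k)"
    proof (rule dvd_in_sum[OF D])
      fix k assume k: "k \<in> {..i+j}-{i}"
      have inD: "coeff a k \<in> D" "coeff b (i+j-k) \<in> D" using ab by (auto simp: polys_over_def)
      show "dvd_in D p (?f k)"
      proof (cases "k < i")
        case True then show ?thesis using i(2) inD dvd_in_mult[OF D] by blast
      next
        case False
        then have "i + j - k < j" using k by auto
        then have "dvd_in D p (coeff b (i + j - k) * coeff a k)" using j(2) inD dvd_in_mult[OF D] by blast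
        then show ?thesis by (simp only: mult.commute)
      qed
    qed
    moreover have "dvd_in D p (coeff (a * b) (i + j))" using ab(3) dvd_in_const_iff[OF D] by blast
    ultimately have "dvd_in D p (?f i)"
      unfolding split using dvd_in_diff[OF D] by blast
    then have "dvd_in D p (coeff a i * coeff b j)" by simp
    moreover have "coeff a i \<in> D" "coeff b j \<in> D" using ab(1,2) unfolding polys_over_def by blast+
    ultimately show False using prime_or_unitD[OF p, of "coeff a i" "coeff b j"] i(1) j(1) by argo
  qed
qed

lemma prime_product_nonzero_in:
  assumes "subring_set (D::'a::idom set)" "prime_product D c" shows "c \<in> D \<and> c \<noteq> 0"
  using assms(2)
  by induction (simp_all add: prime_or_unit_in subring_setD(4)[OF assms(1)])

lemma prime_product_mult:
  assumes "prime_product D a" "prime_product D b"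
  shows "prime_product D (a * b)"
  using assms(1)
proof induction
  case (single p)
  show ?case by (rule prime_product.mult[OF single assms(2)])
next
  case (mult p q)
  show ?case unfolding mult.assoc by (rule prime_product.mult[OF mult.hyps(1) mult.IH])
qed

lemma prime_product_const:
  assumes D: "subring_set D"
  shows "prime_product D c \<Longrightarrow> prime_product (polys_over D) [:c:]"
proof (induction rule: prime_product.induct)
  case (single p)
  show ?case by (rule prime_product.single[OF prime_or_unit_const[OF D single]])
next
  case (mult p q)
  have "prime_product (polys_over D) ([:p:] * [:q:])"
    by (rule prime_product.mult[OF prime_or_unit_const[OF D mult.hyps(1)] mult.IH])
  then show ?case by (simp add: mult.commute)
qed

text \<open>A constant that divides a product can be distributed over the two factors, one prime at a time.
  This is what clears the denominators introduced by pseudo-division.\<close>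

lemma cancel_const:
  fixes D :: "'a::idom set"
  assumes D: "subring_set D" and c: "prime_product D c"
    and "s \<in> polys_over D" "q \<in> polys_over D" "w \<in> polys_over D" "[:c:] * s = q * w"
  shows "\<exists>c1\<in>D. \<exists>c2\<in>D. \<exists>q1\<in>polys_over D. \<exists>w1\<in>polys_over D.
    c = c1 * c2 \<and> q = [:c1:] * q1 \<and> w = [:c2:] * w1 \<and> s = q1 * w1"
proof -
  have step: "\<exists>q1\<in>polys_over D. \<exists>w1\<in>polys_over D.
      (q = [:p:] * q1 \<and> w = w1 \<or> q = q1 \<and> w = [:p:] * w1) \<and> s = q1 * w1"
    if p: "prime_or_unit D p" and "s \<in> polys_over D" and qw: "q \<in> polys_over D" "w \<in> polys_over D"
      and eq: "[:p:] * s = q * w" for p s q w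
  proof -
    have "p \<noteq> 0" using prime_or_unit_in(2)[OF p] .
    then have p0: "[:p:] \<noteq> 0" by simp
    have "dvd_in (polys_over D) [:p:] (q * w)" unfolding dvd_in_def using that(2) eq by metis
    then consider "dvd_in (polys_over D) [:p:] q" | "dvd_in (polys_over D) [:p:] w"
      using prime_or_unitD[OF prime_or_unit_const[OF D p] qw] by argo
    then show ?thesis
    proof cases
      case 1
      then obtain q1 where q1: "q1 \<in> polys_over D" "q = [:p:] * q1" unfolding dvd_in_def by blast
      have "[:p:] * s = [:p:] * (q1 * w)" using eq q1 by (simp only: mult.assoc)
      then have "s = q1 * w" using p0 mult_cancel_left by blast
      then show ?thesis using q1 qw by blast
    next
      case 2
      then obtain w1 where w1: "w1 \<in> polys_over D" "w = [:p:] * w1" unfolding dvd_in_def by blast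
      have "[:p:] * s = [:p:] * (q * w1)" using eq w1 by (simp only: mult.left_commute)
      then have "s = q * w1" using p0 mult_cancel_left by blast
      then show ?thesis using w1 qw by blast
    qed
  qed
  note one = subring_setD(1)[OF D]
  show ?thesis using c assms(3-)
  proof (induction arbitrary: s q w rule: prime_product.induct)
    case (single p)
    obtain q1 w1 where *: "q1 \<in> polys_over D" "w1 \<in> polys_over D" "s = q1 * w1"
      "q = [:p:] * q1 \<and> w = w1 \<or> q = q1 \<and> w = [:p:] * w1"
      using step[OF single(1-5)] by blast
    have pD: "p \<in> D" using prime_or_unit_in(1)[OF single(1)] .
    from *(4) show ?case
    proof
      assume "q = [:p:] * q1 \<and> w = w1"
      then have "p = p * 1 \<and> q = [:p:] * q1 \<and> w = [:1:] * w1 \<and> s = q1 * w1" using *(3) by simp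
      then show ?thesis using *(1,2) pD one by blast
    next
      assume "q = q1 \<and> w = [:p:] * w1"
      then have "p = 1 * p \<and> q = [:1:] * q1 \<and> w = [:p:] * w1 \<and> s = q1 * w1" using *(3) by simp
      then show ?thesis using *(1,2) pD one by blast
    qed
  next
    case (mult p c)
    have pD: "p \<in> D" using prime_or_unit_in(1)[OF mult(1)] .
    have cD: "c \<in> D" using prime_product_nonzero_in[OF D mult(2)] by simp
    have S: "[:c:] * s \<in> polys_over D"
      using subring_setD(4)[OF subring_polys_over[OF D]] const_in_polys_over[OF D cD] mult by blast
    have "[:p:] * ([:c:] * s) = q * w" using mult(7) by (simp add: mult_ac)
    from step[OF mult(1) S mult(5,6) this]
    obtain q0 w0 where *: "q0 \<in> polys_over D" "w0 \<in> polys_over D" "[:c:] * s = q0 * w0"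
      "q = [:p:] * q0 \<and> w = w0 \<or> q = q0 \<and> w = [:p:] * w0" by blast
    obtain c1 c2 q1 w1 where **: "c1 \<in> D" "c2 \<in> D" "q1 \<in> polys_over D" "w1 \<in> polys_over D"
      "c = c1 * c2" "q0 = [:c1:] * q1" "w0 = [:c2:] * w1" "s = q1 * w1"
      using mult(3)[OF mult(4) *(1,2,3)] by blast
    have D4: "p * c1 \<in> D" "p * c2 \<in> D" using subring_setD(4)[OF D] pD **(1,2) by blast+
    from *(4) show ?case
    proof
      assume as: "q = [:p:] * q0 \<and> w = w0"
      have "q = [:p * c1:] * q1" using as unfolding **(6) by (simp add: mult.commute)
      moreover have "p * c = (p * c1) * c2" unfolding **(5) by (simp only: mult.assoc)
      ultimately show ?thesis using as **(2,3,4,7,8) D4(1) by blast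
    next
      assume as: "q = q0 \<and> w = [:p:] * w0"
      have "w = [:p * c2:] * w1" using as unfolding **(7) by (simp add: mult.commute)
      moreover have "p * c = c1 * (p * c2)" unfolding **(5) by (simp only: mult_ac)
      ultimately show ?thesis using as **(1,3,4,6,8) D4(2) by blast
    qed
  qed
qed

text \<open>Euclid's algorithm over the fraction field, with denominators cleared: subtracting suitable
  multiples of \<open>w\<close> from a multiple of \<open>z\<close> lowers the degree until nothing is left.\<close>

lemma min_degree_pseudo_divides:
  fixes D :: "'a::idom set"
  assumes D: "subring_set D"
    and J: "J \<subseteq> polys_over D"
    and Jd: "\<And>u z v y. u \<in> polys_over D \<Longrightarrow> v \<in> polys_over D \<Longrightarrow> z \<in> J \<Longrightarrow> y \<in> J \<Longrightarrow> u * z - v * y \<in> J"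
    and w: "w \<in> J" "w \<noteq> 0" "\<And>y. y \<in> J \<Longrightarrow> y \<noteq> 0 \<Longrightarrow> degree w \<le> degree y"
  shows "z \<in> J \<Longrightarrow> \<exists>c\<in>D. \<exists>q\<in>polys_over D. c \<noteq> 0 \<and> [:c:] * z = q * w"
proof (induction "degree z" arbitrary: z rule: less_induct)
  case less
  note DX = subring_setD[OF subring_polys_over[OF D]]
  show ?case
  proof (cases "z = 0")
    case True
    then show ?thesis using subring_setD[OF D] DX
      by (intro bexI[of _ 1] bexI[of _ 0]) auto
  next
    case False
    have le: "degree w \<le> degree z" using w(3) less(2) False .
    let ?k = "degree z - degree w"
    let ?b = "lead_coeff w" let ?a = "lead_coeff z"
    have inD: "?b \<in> D" "?a \<in> D" using J w(1) less(2) by (auto simp: polys_over_def)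
    let ?M = "monom ?a ?k"
    let ?y = "[:?b:] * z - ?M * w"
    have M: "?M \<in> polys_over D" using monom_in_polys_over[OF D] inD by blast
    have yJ: "?y \<in> J"
      by (rule Jd) (use M inD const_in_polys_over[OF D] less(2) w(1) in auto)
    have b0: "?b \<noteq> 0" using w(2) by simp
    have fin: "\<exists>c\<in>D. \<exists>q\<in>polys_over D. c \<noteq> 0 \<and> [:c:] * z = q * w"
      if c: "c \<in> D" "q \<in> polys_over D" "c \<noteq> 0" "[:c:] * ?y = q * w" for c q
    proof -
      have "[:c * ?b:] * z = (q + [:c:] * ?M) * w"
      proof -
        have "[:c * ?b:] * z = [:c:] * ?y + [:c:] * (?M * w)"
          by (simp add: smult_diff_right)
        then show ?thesis unfolding c(4) by (simp only: distrib_right mult.assoc)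
      qed
      moreover have "q + [:c:] * ?M \<in> polys_over D"
        using DX M const_in_polys_over[OF D c(1)] c(2) by blast
      moreover have "c * ?b \<in> D" "c * ?b \<noteq> 0" using subring_setD(4)[OF D] c inD b0 by auto
      ultimately show ?thesis by blast
    qed
    show ?thesis
    proof (cases "?y = 0")
      case True
      show ?thesis
        by (rule fin[of 1 0]) (use True DX subring_setD[OF D] in auto)
    next
      case y0: False
      have "degree ?y < degree z"
      proof -
        have c0: "coeff ?y (degree z) = 0" using le by (simp add: coeff_monom_mult)
        have "degree ([:?b:] * z) \<le> degree z" by (simp add: degree_smult_le)
        moreover have "degree (?M * w) \<le> degree z"
          by (rule order.trans[OF degree_mult_le]) (use le degree_monom_le[of ?a ?k] in linarith)
        ultimately have "degree ?y \<le> degree z" using degree_diff_le by blast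
        moreover have "degree ?y \<noteq> degree z" using c0 y0 leading_coeff_0_iff by metis
        ultimately show ?thesis by simp
      qed
      from less(1)[OF this yJ] show ?thesis using fin by blast
    qed
  qed
qed

text \<open>By induction on the degree it suffices to factor a nonconstant \<open>p\<close> that is not a product of two
  nonconstant polynomials. Split off a constant factor of maximal size \<open>N\<close>; what remains, \<open>p'\<close>, is
  primitive. To see that it is prime, let it divide \<open>a b\<close> and take an element \<open>w\<close> of minimal degree in the
  ideal generated by \<open>p'\<close> and \<open>a\<close>. It divides \<open>p'\<close> and \<open>a\<close> up to constants. By indecomposability
  either \<open>w\<close> is \<open>p'\<close> up to constants, so \<open>p'\<close> divides \<open>a\<close>, or \<open>w\<close> is a constant, so that \<open>w b\<close>, and hence
  \<open>b\<close>, is a multiple of \<open>p'\<close>. The size function \<open>N\<close> replaces the ascending chain condition.\<close>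

theorem factorial_polys_over:
  fixes D :: "'a::idom set" and N :: "'a \<Rightarrow> nat"
  assumes D: "subring_set D" and fac: "factorial_set D"
    and N: "\<And>a b. a \<in> D \<Longrightarrow> b \<in> D \<Longrightarrow> a \<noteq> 0 \<Longrightarrow> b \<noteq> 0 \<Longrightarrow> N (a * b) = N a + N b"
    and N0: "\<And>a. a \<in> D \<Longrightarrow> a \<noteq> 0 \<Longrightarrow> N a = 0 \<Longrightarrow> \<exists>b\<in>D. a * b = 1"
  shows "factorial_set (polys_over D)"
  unfolding factorial_set_def
proof (intro ballI impI)
  let ?X = "polys_over D"
  note X = subring_polys_over[OF D]
  note DX = subring_setD[OF X]
  note C = const_in_polys_over[OF D]
  fix p assume "p \<in> ?X" "p \<noteq> 0"
  then show "prime_product ?X p"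
  proof (induction "degree p" arbitrary: p rule: less_induct)
    case less
    show ?case
    proof (cases "degree p = 0")
      case True
      then obtain c where "p = [:c:]" by (meson degree_eq_zeroE)
      then show ?thesis
        using less(2,3) fac prime_product_const[OF D, of c]
        by (auto simp: factorial_set_def polys_over_def coeff_pCons split: nat.splits)
    next
      case dp: False
      show ?thesis
      proof (cases "\<exists>a\<in>?X. \<exists>b\<in>?X. p = a * b \<and> degree a \<noteq> 0 \<and> degree b \<noteq> 0")
        case True
        then obtain a b where ab: "a \<in> ?X" "b \<in> ?X" "p = a * b" "degree a \<noteq> 0" "degree b \<noteq> 0"
          by blast
        then have n: "a \<noteq> 0" "b \<noteq> 0" by auto
        then have "degree p = degree a + degree b" using ab degree_mult_eq by blast
        then have "degree a < degree p" "degree b < degree p" using ab by auto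
        then show ?thesis using less(1) ab n prime_product_mult by blast
      next
        case indec: False
        define S where "S = {c \<in> D. \<exists>p'\<in>?X. p = [:c:] * p'}"
        have lc: "lead_coeff p \<in> D" using less(2) by (auto simp: polys_over_def)
        have Sb: "N c \<le> N (lead_coeff p)" if cS: "c \<in> S" for c
        proof -
          obtain p' where p': "c \<in> D" "p' \<in> ?X" "p = [:c:] * p'" using cS unfolding S_def by blast
          then have "c \<noteq> 0" "p' \<noteq> 0" using less(3) by auto
          moreover have "lead_coeff p = c * lead_coeff p'" unfolding p'(3) by (simp add: lead_coeff_mult)
          moreover have "lead_coeff p' \<in> D" using p' by (auto simp: polys_over_def)
          ultimately show ?thesis using N[OF p'(1), of "lead_coeff p'"] by simp
        qed
        have "1 \<in> S" unfolding S_def using subring_setD[OF D] less(2) by auto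
        then have "\<exists>x. x \<in> S \<and> (\<forall>y. y \<in> S \<longrightarrow> N y \<le> N x)"
          by (rule ex_has_greatest_nat[where b = "Suc (N (lead_coeff p))"])
            (use Sb in \<open>auto simp: less_Suc_eq_le\<close>)
        then obtain c where c: "c \<in> S" "\<And>c'. c' \<in> S \<Longrightarrow> N c' \<le> N c" by auto
        then obtain p' where p': "c \<in> D" "p' \<in> ?X" "p = [:c:] * p'" unfolding S_def by blast
        have c0: "c \<noteq> 0" "p' \<noteq> 0" using p' less(3) by auto
        have prim: "\<exists>b\<in>D. c1 * b = 1" if c1: "c1 \<in> D" "p1 \<in> ?X" "p' = [:c1:] * p1" for c1 p1
        proof -
          have c10: "c1 \<noteq> 0" using c1 c0 by auto
          have "c * c1 \<in> S" unfolding S_def using c1 p' subring_setD(4)[OF D]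
            by (auto simp: mult_ac intro!: bexI[of _ p1])
          then have "N (c * c1) \<le> N c" using c by blast
          then have "N c1 = 0" using N[OF p'(1) c1(1) c0(1) c10] by simp
          then show ?thesis using N0 c1 c10 by blast
        qed
        have indec': "degree a = 0 \<or> degree b = 0" if "a \<in> ?X" "b \<in> ?X" "p' = a * b" for a b
        proof -
          have "p = ([:c:] * a) * b" using p' that by (simp only: mult.assoc)
          moreover have "[:c:] * a \<in> ?X" using C DX p' that by blast
          moreover have "degree ([:c:] * a) = degree a" using c0 by simp
          ultimately show ?thesis using indec that(2) by metis
        qed
        \<comment> \<open>a primitive polynomial absorbs no constant, so constant multiples may be cancelled\<close>
        have cancel: "\<exists>s1\<in>?X. z = p' * s1"
          if h: "r \<in> D" "r \<noteq> 0" "s \<in> ?X" "z \<in> ?X" "[:r:] * z = p' * s" for r s z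
        proof -
          have "prime_product D r" using fac h unfolding factorial_set_def by blast
          from cancel_const[OF D this h(4) p'(2) h(3) h(5)]
          obtain c1 c2 p1 s1 where *: "c1 \<in> D" "c2 \<in> D" "p1 \<in> ?X" "s1 \<in> ?X"
            "p' = [:c1:] * p1" "z = p1 * s1" by blast
          obtain b where b: "b \<in> D" "c1 * b = 1" using prim *(1,3,5) by blast
          have "[:b:] * p' = [:c1 * b:] * p1" unfolding *(5) by (simp add: mult_ac)
          then have "p1 = [:b:] * p'" using b by simp
          then have "z = ([:b:] * p') * s1" using *(6) by simp
          then have "z = p' * ([:b:] * s1)" by (simp only: mult_ac)
          then show ?thesis using C[OF b(1)] DX(4) *(4) by blast
        qed
        have prime: "prime_or_unit ?X p'"
          unfolding prime_or_unit_def
        proof (intro conjI ballI impI)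
          fix a b assume ab: "a \<in> ?X" "b \<in> ?X" "dvd_in ?X p' (a * b)"
          then obtain s where s: "s \<in> ?X" "a * b = p' * s" unfolding dvd_in_def by blast
          define J where "J = {u * p' + v * a | u v. u \<in> ?X \<and> v \<in> ?X}"
          have JX: "J \<subseteq> ?X" unfolding J_def using DX ab p' by auto
          have Jd: "u * z - v * y \<in> J" if uv: "u \<in> ?X" "v \<in> ?X" "z \<in> J" "y \<in> J" for u z v y
          proof -
            obtain u1 v1 u2 v2 where *: "z = u1 * p' + v1 * a" "y = u2 * p' + v2 * a"
              "u1 \<in> ?X" "v1 \<in> ?X" "u2 \<in> ?X" "v2 \<in> ?X" using uv unfolding J_def by blast
            have "u * z - v * y = (u * u1 - v * u2) * p' + (u * v1 - v * v2) * a"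
              unfolding * by (simp add: algebra_simps)
            then show ?thesis unfolding J_def using * uv DX(3,4) by blast
          qed
          have "1 * p' + 0 * a \<in> J" "0 * p' + 1 * a \<in> J" unfolding J_def using DX(1,2) by blast+
          then have p'J: "p' \<in> J" and aJ: "a \<in> J" by simp_all
          have "\<exists>w. (w \<in> J \<and> w \<noteq> 0) \<and> (\<forall>y. y \<in> J \<and> y \<noteq> 0 \<longrightarrow> degree w \<le> degree y)"
            by (rule ex_has_least_nat[where k = p']) (use p'J c0 in auto)
          then obtain w where w: "w \<in> J" "w \<noteq> 0"
            "\<And>y. y \<in> J \<Longrightarrow> y \<noteq> 0 \<Longrightarrow> degree w \<le> degree y" by auto
          have pd: "\<exists>c\<in>D. \<exists>q\<in>?X. c \<noteq> 0 \<and> [:c:] * z = q * w" if "z \<in> J" for z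
            using D JX Jd w that by (rule min_degree_pseudo_divides)
          obtain k q where k: "k \<in> D" "q \<in> ?X" "k \<noteq> 0" "[:k:] * p' = q * w"
            using pd[OF p'J] by blast
          obtain k' q' where k': "k' \<in> D" "q' \<in> ?X" "k' \<noteq> 0" "[:k':] * a = q' * w"
            using pd[OF aJ] by blast
          have wX: "w \<in> ?X" using w JX by blast
          have "prime_product D k" using fac k unfolding factorial_set_def by blast
          from cancel_const[OF D this p'(2) k(2) wX k(4)]
          obtain c1 c2 q1 w1 where *: "c1 \<in> D" "c2 \<in> D" "q1 \<in> ?X" "w1 \<in> ?X" "k = c1 * c2"
            "q = [:c1:] * q1" "w = [:c2:] * w1" "p' = q1 * w1" by blast
          from indec'[OF *(3,4,8)] show "dvd_in ?X p' a \<or> dvd_in ?X p' b"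
          proof
            assume "degree q1 = 0"
            then obtain e where e: "q1 = [:e:]" by (meson degree_eq_zeroE)
            have "coeff q1 0 \<in> D" using *(3) unfolding polys_over_def by blast
            then have eD: "e \<in> D" using e by simp
            obtain e' where e': "e' \<in> D" "e * e' = 1" using prim[OF eD *(4) *(8)[unfolded e]] by blast
            have "w1 = [:e * e':] * w1" using e' by simp
            also have "\<dots> = [:e':] * p'" unfolding *(8) e by simp
            finally have w1: "w1 = [:e':] * p'" .
            have "[:k':] * a = q' * ([:c2:] * ([:e':] * p'))"
              unfolding k'(4) *(7) using w1 by (rule arg_cong)
            also have "\<dots> = p' * (q' * ([:c2:] * [:e':]))" by (simp only: mult_ac)
            finally have "[:k':] * a = p' * (q' * ([:c2:] * [:e':]))" .
            moreover have "q' * ([:c2:] * [:e':]) \<in> ?X"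
              using DX(4) k'(2) C[OF *(2)] C[OF e'(1)] by blast
            ultimately have "dvd_in ?X p' a" unfolding dvd_in_def
              by (intro cancel[OF k'(1,3) _ ab(1)])
            then show ?thesis ..
          next
            assume "degree w1 = 0"
            then have "degree w = 0" unfolding *(7) by simp
            then obtain r where r: "w = [:r:]" by (meson degree_eq_zeroE)
            have "coeff w 0 \<in> D" using wX unfolding polys_over_def by blast
            then have rD: "r \<in> D" "r \<noteq> 0" using r w(2) by auto
            obtain u v where uv: "w = u * p' + v * a" "u \<in> ?X" "v \<in> ?X" using w(1) unfolding J_def by blast
            have "[:r:] * b = u * p' * b + v * (a * b)"
              unfolding r[symmetric] uv(1) by (simp only: distrib_right mult.assoc)
            also have "\<dots> = p' * (u * b + v * s)"
              unfolding s(2) by (simp only: distrib_left mult_ac)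
            finally have eq: "[:r:] * b = p' * (u * b + v * s)" .
            have "u * b + v * s \<in> ?X" using DX(4,5) uv(2,3) ab(2) s(1) by blast
            then have "dvd_in ?X p' b" unfolding dvd_in_def
              by (rule cancel[OF rD _ ab(2) eq])
            then show ?thesis ..
          qed
        qed (use p' c0 in auto)
        have "prime_product D c" using fac p' c0 unfolding factorial_set_def by blast
        then show ?thesis unfolding p'(3)
          using prime_product_const[OF D] prime prime_product_mult prime_product.single by blast
      qed
    qed
  qed
qed

text \<open>All factors but one of an irreducible element are units.\<close>

lemma prime_product_irreducible:
  fixes D :: "'a::idom set"
  assumes D: "subring_set D" and "prime_product D p"
    and "\<And>a b. a \<in> D \<Longrightarrow> b \<in> D \<Longrightarrow> p = a * b \<Longrightarrow> (\<exists>c\<in>D. a * c = 1) \<or> (\<exists>c\<in>D. b * c = 1)"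
  shows "prime_or_unit D p"
proof -
  have assoc: "prime_or_unit D (u * q)" if q: "prime_or_unit D q" and u: "u \<in> D" "v \<in> D" "u * v = 1" for u v q
  proof -
    have "dvd_in D (u * q) z \<longleftrightarrow> dvd_in D q z" for z
    proof
      assume "dvd_in D (u * q) z"
      then obtain c where "c \<in> D" "z = u * q * c" unfolding dvd_in_def by blast
      then have "z = q * (u * c)" by (simp add: mult_ac)
      then show "dvd_in D q z" unfolding dvd_in_def using \<open>c \<in> D\<close> u subring_setD(4)[OF D] by blast
    next
      assume "dvd_in D q z"
      then obtain c where "c \<in> D" "z = q * c" unfolding dvd_in_def by blast
      then have "z = (u * v) * q * c" using u by simp
      then have "z = u * q * (v * c)" by (simp add: mult_ac)
      then show "dvd_in D (u * q) z" unfolding dvd_in_def using \<open>c \<in> D\<close> u subring_setD(4)[OF D] by blast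
    qed
    moreover have "u \<noteq> 0" using u(3) by auto
    moreover have "u * q \<in> D" "u * q \<noteq> 0"
      using prime_or_unit_in[OF q] u(1) calculation(2) subring_setD(4)[OF D] by auto
    ultimately show ?thesis using q unfolding prime_or_unit_def by blast
  qed
  show ?thesis using assms(2,3)
  proof (induction rule: prime_product.induct)
    case (mult p q)
    have pD: "p \<in> D" using prime_or_unit_in(1)[OF mult(1)] .
    have qD: "q \<in> D" using prime_product_nonzero_in[OF D mult(2)] by simp
    from mult(4)[OF pD qD refl] show ?case
    proof
      assume "\<exists>c\<in>D. p * c = 1"
      then obtain v where v: "v \<in> D" "p * v = 1" by blast
      have "prime_or_unit D q"
      proof (rule mult(3))
        fix a b assume ab: "a \<in> D" "b \<in> D" "q = a * b"
        then have "p * q = (p * a) * b" by (simp add: mult_ac)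
        then have "(\<exists>c\<in>D. p * a * c = 1) \<or> (\<exists>c\<in>D. b * c = 1)"
          using mult(4) ab subring_setD(4)[OF D] pD by blast
        moreover have "\<exists>c\<in>D. a * c = 1" if h: "c \<in> D" "p * a * c = 1" for c
          using h pD subring_setD(4)[OF D] by (intro bexI[of _ "p * c"]) (auto simp: mult_ac)
        ultimately show "(\<exists>c\<in>D. a * c = 1) \<or> (\<exists>c\<in>D. b * c = 1)" by blast
      qed
      then show ?thesis using assoc pD v by blast
    next
      assume "\<exists>c\<in>D. q * c = 1"
      then show ?thesis using assoc[OF mult(1) qD] by (metis mult.commute)
    qed
  qed
qed

section \<open>The graded polynomial ring and its derivations\<close>

abbreviation lookup :: "('a \<Rightarrow>\<^sub>0 'b::zero) \<Rightarrow> 'a \<Rightarrow> 'b" where "lookup \<equiv> Poly_Mapping.lookup"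
abbreviation monomial :: "('n \<Rightarrow>\<^sub>0 nat) \<Rightarrow> 'k \<Rightarrow> ('n, 'k::comm_ring_1) mpol" where
  "monomial \<equiv> Poly_Mapping.single"
abbreviation unit_exp :: "'n \<Rightarrow> ('n \<Rightarrow>\<^sub>0 nat)" where
  "unit_exp j \<equiv> Poly_Mapping.single j 1"

lemma mpol_sum_monoms: "p = (\<Sum>t\<in>Poly_Mapping.keys p. monomial t (lookup p t))"
  by (rule poly_mapping_eqI)
    (simp add: lookup_sum lookup_single when_def sum.delta' in_keys_iff)

text \<open>The monomials are restricted to those that occur in \<open>p\<close>, so that an induction may use what is
  known about the exponents of \<open>p\<close>.\<close>

lemma mpol_induct [case_names zero monomial add]:
  fixes p :: "('n, 'k::comm_ring_1) mpol"
  assumes "P 0" "\<And>t c. t \<in> Poly_Mapping.keys p \<Longrightarrow> P (monomial t c)" "\<And>a b. P a \<Longrightarrow> P b \<Longrightarrow> P (a + b)"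
  shows "P p"
proof -
  have "P (\<Sum>t\<in>A. monomial t (lookup p t))" if "A \<subseteq> Poly_Mapping.keys p" for A
    using finite_subset[OF that finite_keys] that
    by (induction A rule: finite_induct) (simp_all add: assms)
  from this[of "Poly_Mapping.keys p"] show ?thesis unfolding mpol_sum_monoms[of p, symmetric] by simp
qed

lemma var_power: "var j ^ k = monomial (Poly_Mapping.single j k) 1"
  by (induction k) (simp_all add: var_def mult_single single_add[symmetric])

lemma lookup_mult_monomial: "lookup (a * monomial s c) (w + s) = lookup a w * c"
proof (induction a rule: mpol_induct)
  case (monomial t d)
  show ?case by (simp add: mult_single lookup_single when_def)
next
  case (add a b)
  then show ?case by (simp add: distrib_right lookup_add)
qed simp

lemma mon_degree_zero [simp]: "mon_degree 0 = 0"
  by (simp add: mon_degree_def)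

lemma mon_degree_add: "mon_degree (s + t) = mon_degree s + mon_degree t"
  by (simp add: mon_degree_def lookup_add sum.distrib)

lemma mon_degree_single [simp]: "mon_degree (Poly_Mapping.single j k) = k"
  by (simp add: mon_degree_def lookup_single when_def)

lemma lookup_hom_component:
  "lookup (hom_component r p) t = (if mon_degree t = r then lookup p t else 0)"
  unfolding hom_component_def
  by (simp add: lookup_sum lookup_single when_def sum.delta' in_keys_iff)

lemma hom_component_add: "hom_component r (p + q) = hom_component r p + hom_component r q"
  by (rule poly_mapping_eqI) (simp add: lookup_hom_component lookup_add)

lemma hom_component_zero [simp]: "hom_component r 0 = 0"
  by (rule poly_mapping_eqI) (simp add: lookup_hom_component)

lemma hom_component_sum: "hom_component r (\<Sum>i\<in>I. g i) = (\<Sum>i\<in>I. hom_component r (g i))"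
  by (induction I rule: infinite_finite_induct) (simp_all add: hom_component_add)

lemma homogeneous_iff: "homogeneous r p \<longleftrightarrow> (\<forall>t. lookup p t \<noteq> 0 \<longrightarrow> mon_degree t = r)"
  by (auto simp: homogeneous_def in_keys_iff)

lemma homogeneous_hom_component: "homogeneous r (hom_component r p)"
  by (simp add: homogeneous_iff lookup_hom_component)

lemma hom_component_homogeneous:
  "homogeneous r p \<Longrightarrow> hom_component s p = (if s = r then p else 0)"
  by (rule poly_mapping_eqI) (auto simp: homogeneous_iff lookup_hom_component)

lemma homogeneous_zero [simp]: "homogeneous r 0"
  by (simp add: homogeneous_iff)

lemma homogeneous_add: "homogeneous r p \<Longrightarrow> homogeneous r q \<Longrightarrow> homogeneous r (p + q)"
  unfolding homogeneous_iff lookup_add by (metis add.right_neutral)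

lemma homogeneous_uminus: "homogeneous r p \<Longrightarrow> homogeneous r (- p)"
  unfolding homogeneous_iff lookup_uminus by simp

lemma homogeneous_diff: "homogeneous r p \<Longrightarrow> homogeneous r q \<Longrightarrow> homogeneous r (p - q)"
  using homogeneous_add[of r p "- q"] homogeneous_uminus[of r q] by simp

lemma homogeneous_sum: "(\<And>i. i \<in> I \<Longrightarrow> homogeneous r (g i)) \<Longrightarrow> homogeneous r (\<Sum>i\<in>I. g i)"
  by (induction I rule: infinite_finite_induct) (simp_all add: homogeneous_add)

lemma homogeneous_monom: "homogeneous (mon_degree t) (monomial t c)"
  by (simp add: homogeneous_iff lookup_single when_def)

lemma homogeneous_mult:
  fixes p q :: "('n::finite, 'k::comm_ring_1) mpol"
  assumes "homogeneous r p" "homogeneous s q" shows "homogeneous (r + s) (p * q)"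
  unfolding homogeneous_def
proof
  fix t assume "t \<in> Poly_Mapping.keys (p * q)"
  then obtain a b where "t = a + b" "a \<in> Poly_Mapping.keys p" "b \<in> Poly_Mapping.keys q"
    using keys_mult[of p q] by blast
  then show "mon_degree t = r + s" using assms by (simp add: homogeneous_def mon_degree_add)
qed

lemma homogeneous_const: "homogeneous 0 (monomial 0 c)"
  using homogeneous_monom[of 0 c] by simp

lemma homogeneous_one: "homogeneous 0 1"
  using homogeneous_const[of 1] by simp

lemma homogeneous_of_nat_mult: "homogeneous r p \<Longrightarrow> homogeneous r (of_nat k * p)"
  using homogeneous_mult[OF homogeneous_const[of "of_nat k"], of r p] by simp

lemma homogeneous_power: "homogeneous r p \<Longrightarrow> homogeneous (k * r) (p ^ k)"
  by (induction k) (auto simp: homogeneous_one dest: homogeneous_mult)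

lemma homogeneous_prod:
  "(\<And>i. i \<in> I \<Longrightarrow> homogeneous (d i) (g i)) \<Longrightarrow> homogeneous (\<Sum>i\<in>I. d i) (\<Prod>i\<in>I. g i)"
  by (induction I rule: infinite_finite_induct) (simp_all add: homogeneous_one homogeneous_mult)

lemma homogeneous_var: "homogeneous 1 (var j)"
  unfolding var_def using homogeneous_monom[of "unit_exp j" 1] by simp

lemma sum_hom_components: "\<exists>B. \<forall>C\<ge>B. p = (\<Sum>s\<le>C. hom_component s p)"
proof (intro exI allI impI)
  let ?B = "\<Sum>t\<in>Poly_Mapping.keys p. mon_degree t"
  fix C assume C: "?B \<le> C"
  show "p = (\<Sum>s\<le>C. hom_component s p)"
  proof (rule poly_mapping_eqI)
    fix t
    have "mon_degree t \<le> C" if "lookup p t \<noteq> 0"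
      using member_le_sum[of t "Poly_Mapping.keys p" mon_degree] that C by (simp add: in_keys_iff)
    then show "lookup p t = lookup (\<Sum>s\<le>C. hom_component s p) t"
      by (auto simp: lookup_sum lookup_hom_component)
  qed
qed

lemma hom_component_mult:
  fixes p q :: "('n::finite, 'k::comm_ring_1) mpol"
  shows "hom_component r (p * q) = (\<Sum>i\<le>r. hom_component i p * hom_component (r - i) q)"
proof -
  obtain B1 where B1: "\<And>C. C \<ge> B1 \<Longrightarrow> p = (\<Sum>s\<le>C. hom_component s p)" using sum_hom_components by blast
  obtain B2 where B2: "\<And>C. C \<ge> B2 \<Longrightarrow> q = (\<Sum>s\<le>C. hom_component s q)" using sum_hom_components by blast
  define C where "C = max r (max B1 B2)"
  have "p * q = (\<Sum>i\<le>C. hom_component i p) * (\<Sum>j\<le>C. hom_component j q)"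
    by (rule arg_cong2[where f = "(*)", OF B1 B2]) (auto simp: C_def)
  also have "\<dots> = (\<Sum>i\<le>C. \<Sum>j\<le>C. hom_component i p * hom_component j q)"
    by (rule sum_product)
  finally have "hom_component r (p * q) =
      (\<Sum>i\<le>C. \<Sum>j\<le>C. hom_component r (hom_component i p * hom_component j q))"
    by (simp add: hom_component_sum)
  also have "\<dots> = (\<Sum>i\<le>C. \<Sum>j\<le>C. if r = i + j then hom_component i p * hom_component j q else 0)"
    by (intro sum.cong refl hom_component_homogeneous homogeneous_mult homogeneous_hom_component)
  also have "\<dots> = (\<Sum>i\<le>C. if i \<le> r then hom_component i p * hom_component (r - i) q else 0)"
  proof (rule sum.cong[OF refl])
    fix i assume "i \<in> {..C}"
    show "(\<Sum>j\<le>C. if r = i + j then hom_component i p * hom_component j q else 0) =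
        (if i \<le> r then hom_component i p * hom_component (r - i) q else 0)"
    proof (cases "i \<le> r")
      case True
      have "(\<Sum>j\<le>C. if r = i + j then hom_component i p * hom_component j q else 0) =
          (\<Sum>j\<le>C. if j = r - i then hom_component i p * hom_component j q else 0)"
        by (rule sum.cong) (use True in auto)
      also have "\<dots> = hom_component i p * hom_component (r - i) q" by (simp add: C_def)
      finally show ?thesis using True by simp
    qed (auto intro: sum.neutral)
  qed
  also have "\<dots> = (\<Sum>i\<le>r. hom_component i p * hom_component (r - i) q)"
    by (rule sum.mono_neutral_cong_right) (auto simp: C_def)
  finally show ?thesis .
qed

lemma hom_component_mult_homogeneous:
  fixes c g :: "('n::finite, 'k::comm_ring_1) mpol"
  assumes g: "homogeneous e g"
  shows "hom_component r (c * g) = (if e \<le> r then hom_component (r - e) c * g else 0)"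
proof -
  have "hom_component r (c * g) = (\<Sum>i\<le>r. hom_component i c * (if r - i = e then g else 0))"
    by (simp add: hom_component_mult hom_component_homogeneous[OF g])
  also have "\<dots> = (\<Sum>i\<le>r. if e \<le> r \<and> i = r - e then hom_component i c * g else 0)"
    by (rule sum.cong) auto
  also have "\<dots> = (if e \<le> r then hom_component (r - e) c * g else 0)" by simp
  finally show ?thesis .
qed

lemma finite_hom_components: "finite {a. hom_component a p \<noteq> 0}"
proof -
  obtain B where B: "\<And>C. C \<ge> B \<Longrightarrow> p = (\<Sum>s\<le>C. hom_component s p)" using sum_hom_components by blast
  have "i \<le> B" if nz: "hom_component i p \<noteq> 0" for i
  proof (rule ccontr)
    assume "\<not> i \<le> B"
    have "hom_component i p = hom_component i (\<Sum>s\<le>B. hom_component s p)"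
      by (rule arg_cong[OF B]) simp
    also have "\<dots> = (\<Sum>s\<le>B. hom_component i (hom_component s p))" by (rule hom_component_sum)
    also have "\<dots> = 0"
      using \<open>\<not> i \<le> B\<close>
      by (intro sum.neutral) (auto simp: hom_component_homogeneous[OF homogeneous_hom_component])
    finally show False using nz by simp
  qed
  then have "{a. hom_component a p \<noteq> 0} \<subseteq> {..B}" by auto
  then show ?thesis by (rule finite_subset) simp
qed

lemma ex_extreme_component:
  assumes "p \<noteq> 0"
  shows "\<exists>a. hom_component a p \<noteq> 0 \<and> (\<forall>i>a. hom_component i p = 0)"
    and "\<exists>a. hom_component a p \<noteq> 0 \<and> (\<forall>i<a. hom_component i p = 0)"
proof -
  obtain B where B: "\<And>C. C \<ge> B \<Longrightarrow> p = (\<Sum>s\<le>C. hom_component s p)" using sum_hom_components by blast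
  let ?S = "{a. hom_component a p \<noteq> 0}"
  have ne: "?S \<noteq> {}"
  proof
    assume "?S = {}"
    then have "(\<Sum>s\<le>B. hom_component s p) = 0" by simp
    then have "p = 0" by (rule trans[OF B, OF order_refl])
    then show False using assms by simp
  qed
  note fin = finite_hom_components[of p]
  show "\<exists>a. hom_component a p \<noteq> 0 \<and> (\<forall>i>a. hom_component i p = 0)"
    using Max_in[OF fin ne] Max_ge[OF fin] by (intro exI[of _ "Max ?S"]) (auto simp: not_less[symmetric])
  show "\<exists>a. hom_component a p \<noteq> 0 \<and> (\<forall>i<a. hom_component i p = 0)"
    using Min_in[OF fin ne] Min_le[OF fin] by (intro exI[of _ "Min ?S"]) (auto simp: not_less[symmetric])
qed

text \<open>The degree of the highest nonzero component; unspecified for the zero polynomial.\<close>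

definition total_degree :: "('n::finite, 'k::comm_ring_1) mpol \<Rightarrow> nat" where
  "total_degree p = (SOME a. hom_component a p \<noteq> 0 \<and> (\<forall>i>a. hom_component i p = 0))"

lemma total_degree:
  assumes "p \<noteq> 0"
  shows "hom_component (total_degree p) p \<noteq> 0" "i > total_degree p \<Longrightarrow> hom_component i p = 0"
  using someI_ex[OF ex_extreme_component(1)[OF assms]] unfolding total_degree_def[symmetric] by blast+

lemma total_degree_eqI:
  assumes "hom_component a p \<noteq> 0" "\<And>i. i > a \<Longrightarrow> hom_component i p = 0"
  shows "total_degree p = a"
proof -
  have "p \<noteq> 0" using assms(1) by auto
  note t = total_degree[OF this]
  have "\<not> a < total_degree p" using assms(2) t(1) by blast
  moreover have "\<not> total_degree p < a" using assms(1) t(2) by blast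
  ultimately show ?thesis by simp
qed

text \<open>At the two ends of the product of the gradings only one pair of components meets. For the top
  this makes degrees additive; together with the bottom it shows that factors of forms are forms.\<close>

lemma hom_component_extreme_mult:
  fixes p q :: "('n::finite, 'k::comm_ring_1) mpol"
  assumes "(\<forall>i>a. hom_component i p = 0) \<and> (\<forall>i>b. hom_component i q = 0)
    \<or> (\<forall>i<a. hom_component i p = 0) \<and> (\<forall>i<b. hom_component i q = 0)"
  shows "hom_component (a + b) (p * q) = hom_component a p * hom_component b q"
proof -
  have z: "hom_component i p * hom_component (a + b - i) q = 0" if "i \<le> a + b" "i \<noteq> a" for i
  proof -
    have "i > a \<and> a + b - i < b \<or> i < a \<and> a + b - i > b" using that by auto
    then show ?thesis using assms by auto
  qed
  have "hom_component (a + b) (p * q) = (\<Sum>i\<in>{a}. hom_component i p * hom_component (a + b - i) q)"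
    unfolding hom_component_mult by (rule sum.mono_neutral_right) (use z in auto)
  then show ?thesis by simp
qed

lemma total_degree_mult:
  fixes p q :: "('n::{finite,linorder}, 'k::field) mpol"
  assumes "p \<noteq> 0" "q \<noteq> 0"
  shows "total_degree (p * q) = total_degree p + total_degree q"
proof (rule total_degree_eqI)
  show "hom_component (total_degree p + total_degree q) (p * q) \<noteq> 0"
    using total_degree(1)[OF assms(1)] total_degree(1)[OF assms(2)]
      total_degree(2)[OF assms(1)] total_degree(2)[OF assms(2)]
    by (subst hom_component_extreme_mult) simp_all
  fix i assume i: "i > total_degree p + total_degree q"
  show "hom_component i (p * q) = 0" unfolding hom_component_mult
  proof (rule sum.neutral, rule ballI)
    fix k assume "k \<in> {..i}"
    then have "k > total_degree p \<or> i - k > total_degree q" using i by auto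
    then have "hom_component k p = 0 \<or> hom_component (i - k) q = 0"
      using total_degree(2)[OF assms(1)] total_degree(2)[OF assms(2)] by blast
    then show "hom_component k p * hom_component (i - k) q = 0" by auto
  qed
qed

lemma homogeneousI_component:
  assumes "\<And>i. i \<noteq> a \<Longrightarrow> hom_component i p = 0" shows "homogeneous a p"
  unfolding homogeneous_iff
proof (intro allI impI)
  fix t assume t: "lookup p t \<noteq> 0"
  have "hom_component (mon_degree t) p \<noteq> 0"
    using t lookup_hom_component[of "mon_degree t" p t] by auto
  then show "mon_degree t = a" using assms by blast
qed

lemma homogeneous_total_degree:
  assumes "homogeneous r p" "p \<noteq> 0" shows "total_degree p = r"
  by (rule total_degree_eqI) (use assms hom_component_homogeneous[OF assms(1)] in auto)

text \<open>Lowest degrees add up to \<open>r\<close> and so do highest degrees, hence they agree in each factor.\<close>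

lemma homogeneous_factor:
  fixes p q :: "('n::{finite,linorder}, 'k::field) mpol"
  assumes h: "homogeneous r (p * q)" and "p * q \<noteq> 0"
  shows "homogeneous (total_degree p) p"
proof -
  have n: "p \<noteq> 0" "q \<noteq> 0" using assms by auto
  obtain a where a: "hom_component a p \<noteq> 0" "\<forall>i<a. hom_component i p = 0"
    using ex_extreme_component(2)[OF n(1)] by blast
  obtain b where b: "hom_component b q \<noteq> 0" "\<forall>i<b. hom_component i q = 0"
    using ex_extreme_component(2)[OF n(2)] by blast
  note tp = total_degree[OF n(1)] and tq = total_degree[OF n(2)]
  have "hom_component (a + b) (p * q) \<noteq> 0" using a b by (subst hom_component_extreme_mult) auto
  then have "a + b = r" using hom_component_homogeneous[OF h] by metis
  moreover have "total_degree p + total_degree q = r"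
    using total_degree_mult[OF n] homogeneous_total_degree[OF assms] by simp
  moreover have "a \<le> total_degree p" using a(1) tp(2) not_less by blast
  moreover have "b \<le> total_degree q" using b(1) tq(2) not_less by blast
  ultimately have ab: "a = total_degree p" by linarith
  show ?thesis
  proof (rule homogeneousI_component)
    fix i assume "i \<noteq> total_degree p"
    then consider "i < a" | "i > total_degree p" using ab by linarith
    then show "hom_component i p = 0" using a(2) tp(2) by cases blast+
  qed
qed

lemma lookup_pdiff:
  "lookup (pdiff j p) t = of_nat (lookup t j + 1) * lookup p (t + unit_exp j)"
proof -
  let ?g = "\<lambda>s. of_nat (lookup s j) * lookup p s"
  have "lookup (pdiff j p) t = (\<Sum>s\<in>Poly_Mapping.keys p. ?g s when s - unit_exp j = t)"
    by (simp add: pdiff_def lookup_sum lookup_single)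
  also have "\<dots> = (\<Sum>s\<in>Poly_Mapping.keys p. if s = t + unit_exp j then ?g s else 0)"
  proof (rule sum.cong[OF refl])
    fix s
    show "(?g s when s - unit_exp j = t) = (if s = t + unit_exp j then ?g s else 0)"
    proof (cases "s = t + unit_exp j")
      case False
      have "lookup s j = 0" if "s - unit_exp j = t"
      proof (rule ccontr)
        assume "lookup s j \<noteq> 0"
        then have "s = (s - unit_exp j) + unit_exp j"
          by (intro poly_mapping_eqI) (auto simp: lookup_add lookup_minus lookup_single when_def)
        then show False using False that by simp
      qed
      then show ?thesis using False by (simp add: when_def)
    qed simp
  qed
  also have "\<dots> = ?g (t + unit_exp j)" by (simp add: sum.delta' in_keys_iff)
  finally show ?thesis by (simp add: lookup_add)
qed

lemma pdiff_add: "pdiff j (p + q) = pdiff j p + pdiff j q"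
  by (rule poly_mapping_eqI) (simp add: lookup_pdiff lookup_add distrib_left)

lemma pdiff_zero [simp]: "pdiff j 0 = 0"
  by (simp add: pdiff_def)

lemma pdiff_monom:
  "pdiff j (monomial s c) = monomial (s - unit_exp j) (of_nat (lookup s j) * c)"
  by (simp add: pdiff_def)

lemma exp_add_unit_minus: "lookup s j \<noteq> 0 \<Longrightarrow> (s - unit_exp j) + unit_exp j = s"
  by (intro poly_mapping_eqI) (auto simp: lookup_add lookup_minus lookup_single when_def)

lemma pdiff_mult_monom:
  "pdiff j (monomial s a * monomial t b) = pdiff j (monomial s a) * monomial t b + monomial s a * pdiff j (monomial t b)"
proof -
  let ?u = "s + t - unit_exp j"
  have 1: "monomial (s - unit_exp j + t) (of_nat (lookup s j) * a * b) = monomial ?u (of_nat (lookup s j) * a * b)"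
  proof (cases "lookup s j = 0")
    case False
    have "s + t = (s - unit_exp j + t) + unit_exp j"
      using exp_add_unit_minus[OF False] by (simp add: ac_simps)
    then show ?thesis by simp
  qed simp
  have 2: "monomial (s + (t - unit_exp j)) (a * (of_nat (lookup t j) * b)) = monomial ?u (a * (of_nat (lookup t j) * b))"
  proof (cases "lookup t j = 0")
    case False
    have "s + t = (s + (t - unit_exp j)) + unit_exp j"
      using exp_add_unit_minus[OF False] by (simp add: ac_simps)
    then show ?thesis by simp
  qed simp
  have "pdiff j (monomial s a * monomial t b) = monomial ?u (of_nat (lookup s j + lookup t j) * (a * b))"
    by (simp add: mult_single pdiff_monom lookup_add)
  also have "\<dots> = monomial ?u (of_nat (lookup s j) * a * b) + monomial ?u (a * (of_nat (lookup t j) * b))"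
    unfolding single_add[symmetric] by (simp add: algebra_simps)
  finally show ?thesis unfolding pdiff_monom mult_single 1 2 .
qed

lemma pdiff_mult: "pdiff j (p * q) = pdiff j p * q + p * pdiff j q"
proof (induction p rule: mpol_induct)
  case (monomial t c)
  show ?case
  proof (induction q rule: mpol_induct)
    case (monomial s d)
    show ?case by (rule pdiff_mult_monom)
  next
    case (add a b)
    then show ?case by (simp add: pdiff_add distrib_left)
  qed simp
next
  case (add a b)
  then show ?case by (simp add: pdiff_add distrib_right)
qed simp

lemma homogeneous_pdiff: "homogeneous d p \<Longrightarrow> homogeneous (d - 1) (pdiff j p)"
  unfolding homogeneous_iff lookup_pdiff
proof (intro allI impI)
  fix t assume h: "\<forall>t. lookup p t \<noteq> 0 \<longrightarrow> mon_degree t = d"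
    and "of_nat (lookup t j + 1) * lookup p (t + unit_exp j) \<noteq> 0"
  then have "lookup p (t + unit_exp j) \<noteq> 0" by (metis mult_zero_right)
  then have "mon_degree (t + unit_exp j) = d" using h by blast
  then show "mon_degree t = d - 1" by (simp add: mon_degree_add)
qed

lemma of_nat_mult_monom: "of_nat k * monomial s a = monomial s (of_nat k * a)"
  using mult_single[of 0 "of_nat k" s a] by simp

lemma euler:
  fixes p :: "('n::finite, 'k::comm_ring_1) mpol"
  assumes "homogeneous d p"
  shows "(\<Sum>j\<in>UNIV. var j * pdiff j p) = of_nat d * p"
proof (induction p rule: mpol_induct)
  case (monomial s c)
  have s: "mon_degree s = d" using assms monomial by (simp add: homogeneous_def)
  have "var j * pdiff j (monomial s c) = monomial s (of_nat (lookup s j) * c)" for j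
  proof (cases "lookup s j = 0")
    case False
    then show ?thesis using exp_add_unit_minus[OF False]
      by (simp add: var_def pdiff_monom mult_single add.commute)
  qed (simp add: pdiff_monom)
  then have "(\<Sum>j\<in>UNIV. var j * pdiff j (monomial s c)) = (\<Sum>j\<in>UNIV. monomial s (of_nat (lookup s j) * c))"
    by simp
  also have "\<dots> = monomial s (\<Sum>j\<in>UNIV. of_nat (lookup s j) * c)"
    by (rule poly_mapping_eqI) (simp add: lookup_sum lookup_single when_def)
  also have "(\<Sum>j\<in>UNIV. of_nat (lookup s j) * c) = of_nat d * c"
    unfolding s[symmetric] mon_degree_def of_nat_sum by (rule sum_distrib_right[symmetric])
  finally show ?case by (simp add: of_nat_mult_monom)
next
  case (add a b)
  then show ?case by (simp add: pdiff_add distrib_left sum.distrib)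
qed simp

section \<open>The polynomial ring is factorial\<close>

lemma prime_or_unit_of_unit:
  fixes D :: "'a::comm_ring_1 set"
  assumes D: "subring_set D" and "p \<in> D" "q \<in> D" and pq: "p * q = 1"
  shows "prime_or_unit D p"
proof -
  have "dvd_in D p a" if "a \<in> D" for a
    unfolding dvd_in_def
  proof
    show "a = p * (q * a)" using pq by (simp add: mult.assoc[symmetric])
    show "q * a \<in> D" using subring_setD(4)[OF D] assms(3) that by blast
  qed
  moreover have "p \<noteq> 0" using pq by auto
  ultimately show ?thesis using assms(2) unfolding prime_or_unit_def by blast
qed

text \<open>Adjoining a transcendental element \<open>x\<close> to \<open>D\<close> inside the ambient ring gives a copy of \<open>D[X]\<close>.\<close>

lemma factorial_set_image_poly:
  fixes D :: "'a::comm_ring_1 set"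
  assumes D: "subring_set D" and fac: "factorial_set (polys_over D)"
    and inj: "\<And>q. q \<in> polys_over D \<Longrightarrow> poly q x = 0 \<Longrightarrow> q = 0"
  shows "factorial_set ((\<lambda>q. poly q x) ` polys_over D)"
proof -
  let ?X = "polys_over D" let ?E = "(\<lambda>q. poly q x) ` ?X"
  note X = subring_setD[OF subring_polys_over[OF D]]
  have inj2: "p = q" if "p \<in> ?X" "q \<in> ?X" "poly p x = poly q x" for p q
    using inj[OF X(3)[OF that(1,2)]] that(3) by simp
  have dvd: "dvd_in ?X p q" if pq: "p \<in> ?X" "q \<in> ?X" "dvd_in ?E (poly p x) (poly q x)" for p q
  proof -
    obtain c where c: "c \<in> ?X" "poly q x = poly p x * poly c x"
      using pq(3) unfolding dvd_in_def by blast
    have "q = p * c" by (rule inj2) (use pq c X(4) in auto)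
    then show ?thesis using c unfolding dvd_in_def by blast
  qed
  have dvd': "dvd_in ?E (poly p x) (poly q x)" if pq: "dvd_in ?X p q" for p q
  proof -
    obtain c where c: "c \<in> ?X" "q = p * c" using pq unfolding dvd_in_def by blast
    then have "poly q x = poly p x * poly c x" by simp
    then show ?thesis using c(1) unfolding dvd_in_def by blast
  qed
  have prime: "prime_or_unit ?E (poly p x)" if p: "prime_or_unit ?X p" for p
  proof -
    note pX = prime_or_unit_in[OF p]
    have "dvd_in ?E (poly p x) (poly a x) \<or> dvd_in ?E (poly p x) (poly b x)"
      if ab: "a \<in> ?X" "b \<in> ?X" "dvd_in ?E (poly p x) (poly a x * poly b x)" for a b
    proof -
      have "dvd_in ?X p (a * b)" by (rule dvd) (use ab pX X(4) in auto)
      from prime_or_unitD[OF p ab(1,2) this] show ?thesis using dvd' by blast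
    qed
    moreover have "poly p x \<noteq> 0" using inj pX by blast
    moreover have "poly p x \<in> ?E" using pX by blast
    ultimately show ?thesis unfolding prime_or_unit_def by blast
  qed
  have prod: "prime_product ?X p \<Longrightarrow> prime_product ?E (poly p x)" for p
  proof (induction rule: prime_product.induct)
    case (single p)
    show ?case by (rule prime_product.single[OF prime[OF single]])
  next
    case (mult p q)
    show ?case unfolding poly_mult
      by (rule prime_product.mult[OF prime[OF mult.hyps(1)] mult.IH])
  qed
  show ?thesis unfolding factorial_set_def
  proof (intro ballI impI)
    fix a assume a: "a \<in> ?E" "a \<noteq> 0"
    then obtain p where p: "p \<in> ?X" "a = poly p x" by blast
    then have "p \<noteq> 0" using a(2) by auto
    then show "prime_product ?E a" using fac p prod unfolding factorial_set_def by blast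
  qed
qed

definition polys_in_vars :: "'n set \<Rightarrow> ('n, 'k::comm_ring_1) mpol set" where
  "polys_in_vars V = {p. \<forall>t. lookup p t \<noteq> 0 \<longrightarrow> (\<forall>j. j \<notin> V \<longrightarrow> lookup t j = 0)}"

lemma polys_in_varsD: "p \<in> polys_in_vars V \<Longrightarrow> lookup p t \<noteq> 0 \<Longrightarrow> j \<notin> V \<Longrightarrow> lookup t j = 0"
  unfolding polys_in_vars_def by blast

lemma monomial_in_vars:
  "(\<And>j. j \<notin> V \<Longrightarrow> lookup t j = 0) \<Longrightarrow> monomial t c \<in> polys_in_vars V"
  unfolding polys_in_vars_def by (simp add: lookup_single when_def)

lemma subring_polys_in_vars: "subring_set (polys_in_vars V :: ('n, 'k::comm_ring_1) mpol set)"
  unfolding subring_set_def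
proof (intro conjI ballI)
  show "1 \<in> (polys_in_vars V :: ('n, 'k) mpol set)"
    using monomial_in_vars[of V 0 "1::'k"] by simp
  fix a b :: "('n, 'k) mpol" assume ab: "a \<in> polys_in_vars V" "b \<in> polys_in_vars V"
  show "a - b \<in> polys_in_vars V"
    unfolding polys_in_vars_def
  proof (intro CollectI allI impI)
    fix t j assume t: "lookup (a - b) t \<noteq> 0" and j: "j \<notin> V"
    from t have "lookup a t \<noteq> 0 \<or> lookup b t \<noteq> 0" by (auto simp: lookup_minus)
    then show "lookup t j = 0"
      using polys_in_varsD[OF ab(1) _ j] polys_in_varsD[OF ab(2) _ j] by (rule disjE)
  qed
  show "a * b \<in> polys_in_vars V"
    unfolding polys_in_vars_def
  proof (intro CollectI allI impI)
    fix t j assume t: "lookup (a * b) t \<noteq> 0" and j: "j \<notin> V"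
    from t have "t \<in> Poly_Mapping.keys (a * b)" by (simp add: in_keys_iff)
    then obtain u w where uw: "t = u + w" "u \<in> Poly_Mapping.keys a" "w \<in> Poly_Mapping.keys b"
      using keys_mult[of a b] by blast
    then have "lookup u j = 0" "lookup w j = 0"
      using polys_in_varsD[OF ab(1) _ j] polys_in_varsD[OF ab(2) _ j] by (simp_all add: in_keys_iff)
    then show "lookup t j = 0" by (simp add: uw(1) lookup_add)
  qed
qed

text \<open>Adjoining one variable: the polynomials in the variables \<open>V \<union> {v}\<close> are the values at \<open>x\<^sub>v\<close> of
  univariate polynomials over \<open>K[x\<^sub>j : j \<in> V]\<close>, and \<open>x\<^sub>v\<close> is transcendental because the coefficient of
  \<open>x\<^sup>t x\<^sub>v\<^sup>i\<close> in such a value reads off the coefficient of \<open>x\<^sup>t\<close> in the \<open>i\<close>-th coefficient.\<close>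

lemma polys_in_vars_insert:
  fixes V :: "'n set"
  assumes v: "v \<notin> V"
  shows "(polys_in_vars (insert v V) :: ('n, 'k::comm_ring_1) mpol set)
    = (\<lambda>q. poly q (var v)) ` polys_over (polys_in_vars V)" (is "?R = ?E")
    and "q \<in> polys_over (polys_in_vars V :: ('n, 'k) mpol set) \<Longrightarrow> poly q (var v) = 0 \<Longrightarrow> q = 0"
proof -
  let ?D = "polys_in_vars V :: ('n, 'k) mpol set"
  note D = subring_polys_in_vars[of V, where ?'k = 'k]
  note R = subring_setD[OF subring_polys_in_vars[of "insert v V", where ?'k = 'k]]
  note X = subring_setD[OF subring_polys_over[OF D]]
  have DR: "?D \<subseteq> ?R" unfolding polys_in_vars_def by blast
  show "?R = ?E"
  proof
    show "?E \<subseteq> ?R"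
    proof
      fix p assume "p \<in> ?E"
      then obtain q where q: "q \<in> polys_over ?D" "p = poly q (var v)" by blast
      have "var v ^ i \<in> ?R" for i
        unfolding var_power by (rule monomial_in_vars) (auto simp: lookup_single when_def)
      moreover have "coeff q i \<in> ?R" for i using q(1) DR unfolding polys_over_def by blast
      ultimately show "p \<in> ?R" unfolding q(2) poly_altdef
        by (intro subring_set_sum[OF subring_polys_in_vars] R(4))
    qed
    show "?R \<subseteq> ?E"
    proof
      fix p :: "('n, 'k) mpol" assume p: "p \<in> ?R"
      show "p \<in> ?E"
      proof (induction p rule: mpol_induct)
        case zero
        show ?case using X(2) by (intro image_eqI[of _ _ 0]) auto
      next
        case (monomial t c)
        let ?s = "t - Poly_Mapping.single v (lookup t v)"
        have "lookup ?s j = 0" if "j \<notin> V" for j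
          using polys_in_varsD[OF p, of t j] monomial that
          by (cases "j = v") (auto simp: lookup_minus lookup_single when_def in_keys_iff)
        then have "Polynomial.monom (monomial ?s c) (lookup t v) \<in> polys_over ?D"
          by (intro monom_in_polys_over[OF D] monomial_in_vars)
        moreover have "poly (Polynomial.monom (monomial ?s c) (lookup t v)) (var v) = monomial t c"
        proof -
          have "?s + Poly_Mapping.single v (lookup t v) = t"
            by (intro poly_mapping_eqI) (auto simp: lookup_add lookup_minus lookup_single when_def)
          then show ?thesis by (simp add: poly_monom var_power mult_single)
        qed
        ultimately show ?case by force
      next
        case (add a b)
        then obtain q r where "q \<in> polys_over ?D" "a = poly q (var v)"
          "r \<in> polys_over ?D" "b = poly r (var v)" by blast
        then show ?case using X(5) by (intro image_eqI[of _ _ "q + r"]) auto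
      qed
    qed
  qed
  assume q: "q \<in> polys_over ?D" and z: "poly q (var v) = 0"
  show "q = 0"
  proof (rule poly_eqI)
    fix i
    have "lookup (coeff q i) t = 0" for t
    proof (rule ccontr)
      assume nz: "lookup (coeff q i) t \<noteq> 0"
      have qD: "coeff q k \<in> ?D" for k using q unfolding polys_over_def by blast
      have tv: "lookup t v = 0" using polys_in_varsD[OF qD nz v] .
      let ?u = "t + Poly_Mapping.single v i"
      have other: "lookup (coeff q k * var v ^ k) ?u = 0" if "k \<noteq> i" for k
      proof (rule ccontr)
        assume "\<not> ?thesis"
        then have "?u \<in> Poly_Mapping.keys (coeff q k * var v ^ k)" by (simp add: in_keys_iff)
        then obtain a b where ab: "?u = a + b" "a \<in> Poly_Mapping.keys (coeff q k)"
          "b \<in> Poly_Mapping.keys (var v ^ k :: ('n, 'k) mpol)"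
          using keys_mult[of "coeff q k" "var v ^ k"] by blast
        have "b = Poly_Mapping.single v k" using ab(3) by (simp add: var_power split: if_splits)
        moreover have "lookup a v = 0" using polys_in_varsD[OF qD _ v] ab(2) by (simp add: in_keys_iff)
        ultimately have "lookup ?u v = k" unfolding ab(1) by (simp add: lookup_add)
        then show False using tv that by (simp add: lookup_add)
      qed
      have i: "i \<le> degree q" using nz by (metis le_degree lookup_zero)
      have "0 = lookup (poly q (var v)) ?u" by (simp add: z)
      also have "\<dots> = (\<Sum>k\<le>degree q. lookup (coeff q k * var v ^ k) ?u)"
        by (simp add: poly_altdef lookup_sum)
      also have "\<dots> = (\<Sum>k\<in>{i}. lookup (coeff q k * var v ^ k) ?u)"
        by (rule sum.mono_neutral_right) (use i other in auto)
      also have "\<dots> = lookup (coeff q i) t"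
        by (simp add: var_power lookup_mult_monomial)
      finally show False using nz by simp
    qed
    then show "coeff q i = coeff 0 i" by (intro poly_mapping_eqI) simp
  qed
qed

lemma degree_zero_const:
  assumes "p \<noteq> 0" "total_degree p = 0"
  shows "\<exists>c. c \<noteq> 0 \<and> p = monomial 0 c"
proof -
  have h: "homogeneous 0 p"
    by (rule homogeneousI_component) (use total_degree(2)[OF assms(1)] assms(2) in auto)
  have "lookup p t = 0" if "t \<noteq> 0" for t
  proof -
    have "mon_degree t \<noteq> 0"
    proof
      assume "mon_degree t = 0"
      then have "t = 0" by (intro poly_mapping_eqI) (simp add: mon_degree_def)
      then show False using that by simp
    qed
    then show ?thesis using homogeneous_iff[THEN iffD1, OF h, rule_format, of t] by argo
  qed
  then have "p = monomial 0 (lookup p 0)"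
    by (intro poly_mapping_eqI) (auto simp: lookup_single when_def)
  then show ?thesis using assms(1) by (metis single_zero)
qed

lemma unit_in_vars:
  fixes p :: "('n::finite, 'k::field) mpol"
  assumes "p \<noteq> 0" "total_degree p = 0"
  shows "\<exists>q\<in>polys_in_vars V. p * q = 1"
proof -
  obtain c where c: "c \<noteq> 0" "p = monomial 0 c" using degree_zero_const[OF assms] by blast
  have "p * monomial 0 (inverse c) = 1" using c by (simp add: mult_single)
  moreover have "monomial 0 (inverse c) \<in> polys_in_vars V" by (rule monomial_in_vars) simp
  ultimately show ?thesis by blast
qed

lemma factorial_polys_in_vars:
  fixes V :: "'n::{finite,linorder} set"
  shows "factorial_set (polys_in_vars V :: ('n, 'k::field) mpol set)"
proof -
  have "finite V" by simp
  then show ?thesis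
  proof (induction V rule: finite_induct)
    case empty
    show ?case unfolding factorial_set_def
    proof (intro ballI impI)
      fix p :: "('n, 'k) mpol" assume p: "p \<in> polys_in_vars {}" "p \<noteq> 0"
      have "homogeneous 0 p" unfolding homogeneous_iff mon_degree_def
        using polys_in_varsD[OF p(1)] by simp
      then have "total_degree p = 0" using homogeneous_total_degree p(2) by blast
      from unit_in_vars[OF p(2) this] show "prime_product (polys_in_vars {}) p"
        using prime_or_unit_of_unit[OF subring_polys_in_vars p(1)] prime_product.single by blast
    qed
  next
    case (insert v V)
    let ?D = "polys_in_vars V :: ('n, 'k) mpol set"
    have "factorial_set (polys_over ?D)"
    proof (rule factorial_polys_over[OF subring_polys_in_vars insert(3)])
      show "total_degree (a * b) = total_degree a + total_degree b" if "a \<noteq> 0" "b \<noteq> 0" for a b :: "('n, 'k) mpol"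
        using total_degree_mult[OF that] .
      show "\<exists>b\<in>?D. a * b = 1" if "a \<noteq> 0" "total_degree a = 0" for a
        using unit_in_vars[OF that] .
    qed
    then show ?case unfolding polys_in_vars_insert(1)[OF insert(2)]
      by (rule factorial_set_image_poly[OF subring_polys_in_vars]) (rule polys_in_vars_insert(2)[OF insert(2)])
  qed
qed

theorem irreducible_imp_prime:
  fixes f a b :: "('n::{finite,linorder}, 'k::field) mpol"
  assumes "f \<noteq> 0" and irr: "\<And>a b. f = a * b \<Longrightarrow> total_degree a = 0 \<or> total_degree b = 0"
    and "f dvd a * b"
  shows "f dvd a \<or> f dvd b"
proof -
  let ?D = "polys_in_vars UNIV :: ('n, 'k) mpol set"
  have UN: "?D = UNIV" unfolding polys_in_vars_def by simp
  have "prime_or_unit ?D f"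
  proof (rule prime_product_irreducible[OF subring_polys_in_vars])
    show "prime_product ?D f"
      using factorial_polys_in_vars[of UNIV, where ?'k = 'k] assms(1) UN unfolding factorial_set_def by blast
    show "(\<exists>c\<in>?D. a * c = 1) \<or> (\<exists>c\<in>?D. b * c = 1)" if "f = a * b" for a b
    proof -
      have "a \<noteq> 0" "b \<noteq> 0" using assms(1) that by auto
      then show ?thesis using irr[OF that] unit_in_vars[of a UNIV] unit_in_vars[of b UNIV] by blast
    qed
  qed
  moreover have "dvd_in ?D p q \<longleftrightarrow> p dvd q" for p q unfolding dvd_in_def dvd_def UN by blast
  ultimately show ?thesis using prime_or_unitD[of ?D f a b] assms(3) UN by auto
qed

section \<open>Regular families and their exchange\<close>

definition is_ideal :: "'a::comm_ring_1 set \<Rightarrow> bool" where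
  "is_ideal I \<longleftrightarrow> 0 \<in> I \<and> (\<forall>a\<in>I. \<forall>b\<in>I. a + b \<in> I) \<and> (\<forall>r. \<forall>a\<in>I. r * a \<in> I)"

definition ideal_of :: "'i set \<Rightarrow> ('i \<Rightarrow> 'a::comm_ring_1) \<Rightarrow> 'a set" where
  "ideal_of J g = {p. \<exists>c. p = (\<Sum>j\<in>J. c j * g j)}"

text \<open>For a homogeneous ideal this says that its zero set in projective space is empty.\<close>

definition contains_var_powers :: "('n::finite, 'k::comm_ring_1) mpol set \<Rightarrow> bool" where
  "contains_var_powers I \<longleftrightarrow> (\<forall>j. \<exists>N. var j ^ N \<in> I)"

text \<open>A regular sequence of \<open>n\<close> forms that stays one in every order, together with its subsequences.
  Stating this for all index sets \<open>J\<close> at once is what makes the exchange of an arbitrary member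
  possible. Only homogeneous \<open>Q\<close> are considered, since the proofs descend on the degree.\<close>

definition regular_family :: "('n::finite \<Rightarrow> ('n, 'k::comm_ring_1) mpol) \<Rightarrow> bool" where
  "regular_family g \<longleftrightarrow> (\<forall>J i t Q. i \<notin> J \<longrightarrow> homogeneous t Q \<longrightarrow> Q * g i \<in> ideal_of J g \<longrightarrow> Q \<in> ideal_of J g)"

lemma is_idealD:
  assumes "is_ideal I"
  shows "0 \<in> I" "a \<in> I \<Longrightarrow> b \<in> I \<Longrightarrow> a + b \<in> I" "a \<in> I \<Longrightarrow> r * a \<in> I" "a \<in> I \<Longrightarrow> a * r \<in> I"
    "a \<in> I \<Longrightarrow> - a \<in> I" "a \<in> I \<Longrightarrow> b \<in> I \<Longrightarrow> a - b \<in> I"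
proof -
  have m: "r * a \<in> I" if "a \<in> I" for a r using assms that unfolding is_ideal_def by simp
  have p: "a + b \<in> I" if "a \<in> I" "b \<in> I" for a b using assms that unfolding is_ideal_def by simp
  show "0 \<in> I" using assms unfolding is_ideal_def by simp
  show "a \<in> I \<Longrightarrow> b \<in> I \<Longrightarrow> a + b \<in> I" by (rule p)
  show "a \<in> I \<Longrightarrow> r * a \<in> I" by (rule m)
  show "a \<in> I \<Longrightarrow> a * r \<in> I" using m[of a r] by (simp add: mult.commute)
  show n: "a \<in> I \<Longrightarrow> - a \<in> I" for a using m[of a "- 1"] by simp
  show "a \<in> I \<Longrightarrow> b \<in> I \<Longrightarrow> a - b \<in> I" using p[of a "- b"] n[of b] by simp
qed

lemma is_ideal_sum: "is_ideal I \<Longrightarrow> (\<And>j. j \<in> J \<Longrightarrow> g j \<in> I) \<Longrightarrow> (\<Sum>j\<in>J. g j) \<in> I"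
  by (induction J rule: infinite_finite_induct) (simp_all add: is_idealD)

lemma ideal_cancel_const:
  fixes c :: "'k::field"
  assumes P: "is_ideal P" and "c \<noteq> 0" "monomial 0 c * p \<in> P"
  shows "p \<in> P"
proof -
  have "monomial 0 (inverse c) * (monomial 0 c * p) \<in> P" by (rule is_idealD(3)[OF P assms(3)])
  then show ?thesis using assms(2) by (simp add: mult.assoc[symmetric] mult_single)
qed

lemma hom_component_not_in_ideal:
  assumes P: "is_ideal P" and x: "x \<notin> P"
  shows "\<exists>s. hom_component s x \<notin> P"
proof (rule ccontr)
  assume n: "\<not> ?thesis"
  obtain B where B: "\<And>C. C \<ge> B \<Longrightarrow> x = (\<Sum>s\<le>C. hom_component s x)" using sum_hom_components by blast
  have "(\<Sum>s\<le>B. hom_component s x) \<in> P"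
    using n by (intro is_ideal_sum[OF P]) simp
  then show False using B[OF order_refl] x by simp
qed

lemma ideal_ofI: "p = (\<Sum>j\<in>J. c j * g j) \<Longrightarrow> p \<in> ideal_of J g"
  unfolding ideal_of_def by blast

lemma ideal_ofE:
  assumes "p \<in> ideal_of J g" obtains c where "p = (\<Sum>j\<in>J. c j * g j)"
  using assms unfolding ideal_of_def by blast

lemma is_ideal_ideal_of: "is_ideal (ideal_of J g)"
  unfolding is_ideal_def
proof (intro conjI ballI allI)
  show "0 \<in> ideal_of J g" by (rule ideal_ofI[of _ "\<lambda>_. 0"]) simp
  fix a assume "a \<in> ideal_of J g"
  then obtain c where c: "a = (\<Sum>j\<in>J. c j * g j)" by (rule ideal_ofE)
  show "r * a \<in> ideal_of J g" for r
    by (rule ideal_ofI[of _ "\<lambda>j. r * c j"]) (simp add: c sum_distrib_left mult.assoc)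
  fix b assume "b \<in> ideal_of J g"
  then obtain d where d: "b = (\<Sum>j\<in>J. d j * g j)" by (rule ideal_ofE)
  show "a + b \<in> ideal_of J g"
    by (rule ideal_ofI[of _ "\<lambda>j. c j + d j"]) (simp add: c d sum.distrib distrib_right)
qed

lemmas ideal_of_closed = is_idealD[OF is_ideal_ideal_of]

lemma ideal_of_least: "is_ideal I \<Longrightarrow> (\<And>j. j \<in> J \<Longrightarrow> g j \<in> I) \<Longrightarrow> ideal_of J g \<subseteq> I"
  by (auto elim!: ideal_ofE intro!: is_ideal_sum is_idealD(3))

lemma ideal_of_generator:
  assumes "finite J" "j \<in> J" shows "g j \<in> ideal_of J g"
proof (rule ideal_ofI[of _ "\<lambda>i. if i = j then 1 else 0"])
  have "(\<Sum>i\<in>J. (if i = j then 1 else 0) * g i) = (\<Sum>i\<in>J. if i = j then g i else 0)"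
    by (rule sum.cong) auto
  then show "g j = (\<Sum>i\<in>J. (if i = j then 1 else 0) * g i)" using assms by simp
qed

lemma ideal_of_mono: "finite J' \<Longrightarrow> J \<subseteq> J' \<Longrightarrow> ideal_of J g \<subseteq> ideal_of J' g"
  by (rule ideal_of_least[OF is_ideal_ideal_of]) (auto intro: ideal_of_generator)

lemma ideal_of_cong:
  assumes "\<And>j. j \<in> J \<Longrightarrow> g j = g' j" shows "ideal_of J g = ideal_of J g'"
proof -
  have "(\<Sum>j\<in>J. c j * g j) = (\<Sum>j\<in>J. c j * g' j)" for c
    by (rule sum.cong) (simp_all add: assms)
  then show ?thesis unfolding ideal_of_def by simp
qed

text \<open>A form in an ideal generated by forms of degree \<open>e\<close> is a combination with homogeneous
  coefficients: keep only the components of the right degree. If its degree is below \<open>e\<close> nothing is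
  kept, which is why the truncated difference \<open>t - e\<close> needs the case distinction.\<close>

lemma homogeneous_coefficients:
  fixes g :: "'i \<Rightarrow> ('n::finite, 'k::comm_ring_1) mpol"
  assumes g: "\<And>j. homogeneous e (g j)" and p: "homogeneous t p" "p \<in> ideal_of J g"
  obtains c where "p = (\<Sum>j\<in>J. c j * g j)" "\<And>j. e \<le> t \<Longrightarrow> homogeneous (t - e) (c j)"
    "\<And>j. t < e \<Longrightarrow> c j = 0"
proof -
  obtain c where c: "p = (\<Sum>j\<in>J. c j * g j)" using p(2) by (rule ideal_ofE)
  let ?c = "\<lambda>j. if e \<le> t then hom_component (t - e) (c j) else 0"
  have "p = hom_component t p" using hom_component_homogeneous[OF p(1), of t] by simp
  also have "\<dots> = (\<Sum>j\<in>J. ?c j * g j)"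
    unfolding c hom_component_sum by (rule sum.cong) (simp_all add: hom_component_mult_homogeneous[OF g])
  finally show ?thesis
    by (rule that) (simp_all add: homogeneous_hom_component)
qed

lemma ideal_of_insertE:
  fixes g :: "'i \<Rightarrow> ('n::finite, 'k::comm_ring_1) mpol"
  assumes g: "\<And>j. homogeneous e (g j)" and p: "homogeneous t p" "p \<in> ideal_of (insert k J) g"
    and J: "finite J" "k \<notin> J"
  obtains c s where "p = c * g k + s" "s \<in> ideal_of J g" "e \<le> t \<Longrightarrow> homogeneous (t - e) c" "t < e \<Longrightarrow> c = 0"
proof -
  from g p obtain c where c: "p = (\<Sum>j\<in>insert k J. c j * g j)"
    "\<And>j. e \<le> t \<Longrightarrow> homogeneous (t - e) (c j)" "\<And>j. t < e \<Longrightarrow> c j = 0"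
    by (rule homogeneous_coefficients) blast
  have "p = c k * g k + (\<Sum>j\<in>J. c j * g j)" unfolding c(1) using J by simp
  moreover have "(\<Sum>j\<in>J. c j * g j) \<in> ideal_of J g" by (rule ideal_ofI) simp
  ultimately show ?thesis using c(2,3) that by blast
qed

lemma low_degree_in_ideal_eq_0:
  fixes g :: "'i \<Rightarrow> ('n::finite, 'k::comm_ring_1) mpol"
  assumes g: "\<And>j. homogeneous e (g j)" and p: "homogeneous t p" "p \<in> ideal_of J g" and "t < e"
  shows "p = 0"
  using g p
proof (rule homogeneous_coefficients)
  fix c assume "p = (\<Sum>j\<in>J. c j * g j)" "\<And>j. t < e \<Longrightarrow> c j = 0"
  then show "p = 0" using \<open>t < e\<close> by simp
qed

lemma monomial_eq_mult_var_power:
  assumes "k \<le> lookup t j"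
  shows "monomial t c = monomial (t - Poly_Mapping.single j k) c * var j ^ k"
proof -
  have "t - Poly_Mapping.single j k + Poly_Mapping.single j k = t"
    using assms by (intro poly_mapping_eqI) (auto simp: lookup_add lookup_minus lookup_single when_def)
  then show ?thesis by (simp add: var_power mult_single)
qed

text \<open>Pigeonhole: a monomial of large degree has a large exponent somewhere.\<close>

lemma contains_high_degrees:
  fixes I :: "('n::finite, 'k::comm_ring_1) mpol set"
  assumes I: "is_ideal I" and c: "contains_var_powers I"
  obtains N where "\<And>t p. N \<le> t \<Longrightarrow> homogeneous t p \<Longrightarrow> p \<in> I"
proof -
  obtain M where M: "\<And>j. var j ^ M j \<in> I" using c unfolding contains_var_powers_def by metis
  have mono: "monomial t c \<in> I" if "(\<Sum>j\<in>UNIV. M j) \<le> mon_degree t" for t c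
  proof -
    have "\<exists>j. M j \<le> lookup t j"
    proof (rule ccontr)
      assume "\<not> ?thesis"
      then have "(\<Sum>j\<in>UNIV. lookup t j) < (\<Sum>j\<in>UNIV. M j)"
        by (intro sum_strict_mono) (auto simp: not_le)
      then show False using that by (simp add: mon_degree_def)
    qed
    then obtain j where "M j \<le> lookup t j" ..
    from monomial_eq_mult_var_power[OF this, of c] show ?thesis
      using is_idealD(3)[OF I M[of j]] by simp
  qed
  show ?thesis
  proof (rule that)
    fix t and p :: "('n, 'k) mpol" assume t: "(\<Sum>j\<in>UNIV. M j) \<le> t" and p: "homogeneous t p"
    have "(\<Sum>s\<in>Poly_Mapping.keys p. monomial s (lookup p s)) \<in> I"
      by (rule is_ideal_sum[OF I]) (rule mono, use t p in \<open>simp add: homogeneous_def\<close>)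
    then show "p \<in> I" unfolding mpol_sum_monoms[symmetric] .
  qed
qed

text \<open>Let first \<open>J\<close> consist of all indices but \<open>i\<close>. Some power of \<open>g\<^sub>i\<close> is congruent to a multiple of \<open>b\<close>
  modulo \<open>(g\<^sub>j : j \<in> J)\<close>, so \<open>Q b \<in> (g\<^sub>j : j \<in> J)\<close> implies \<open>Q g\<^sub>i\<^sup>N \<in> (g\<^sub>j : j \<in> J)\<close> and then
  \<open>Q \<in> (g\<^sub>j : j \<in> J)\<close>. For smaller \<open>J\<close> add an index \<open>k\<close>. By induction \<open>Q = c g\<^sub>k\<close> modulo \<open>(g\<^sub>j : j \<in> J)\<close>,
  where \<open>g\<^sub>k\<close> can be cancelled from \<open>c g\<^sub>k b\<close>, so that \<open>c\<close> is annihilated by \<open>b\<close> as well and has smaller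
  degree.\<close>

lemma exchange_nonzero_divisor:
  fixes g :: "'n::finite \<Rightarrow> ('n, 'k::comm_ring_1) mpol"
  assumes reg: "regular_family g" and g: "\<And>j. homogeneous e (g j)" and e: "e \<ge> 1"
    and b: "homogeneous e b" and cvp: "contains_var_powers (ideal_of UNIV (g(i := b)))"
  shows "i \<notin> J \<Longrightarrow> homogeneous t Q \<Longrightarrow> Q * b \<in> ideal_of J g \<Longrightarrow> Q \<in> ideal_of J g"
proof (induction "card (- J)" arbitrary: J t Q rule: less_induct)
  case less
  have regD: "Q \<in> ideal_of J g" if "k \<notin> J" "homogeneous t Q" "Q * g k \<in> ideal_of J g" for k J t Q
    using reg that unfolding regular_family_def by simp
  show ?case
  proof (cases "J = - {i}")
    case True
    obtain N where N: "\<And>t p. N \<le> t \<Longrightarrow> homogeneous t p \<Longrightarrow> p \<in> ideal_of UNIV (g(i := b))"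
      using contains_high_degrees[OF is_ideal_ideal_of cvp] by blast
    have h: "homogeneous (N * e) (g i ^ N)" by (rule homogeneous_power[OF g])
    have "g i ^ N \<in> ideal_of UNIV (g(i := b))" by (rule N[OF _ h]) (use e in simp)
    moreover have "UNIV = insert i (- {i})" by auto
    ultimately have mem: "g i ^ N \<in> ideal_of (insert i (- {i})) (g(i := b))" by simp
    have g': "homogeneous e ((g(i := b)) j)" for j using g b by simp
    from g' h mem obtain c s where cs: "g i ^ N = c * (g(i := b)) i + s"
      "s \<in> ideal_of (- {i}) (g(i := b))" by (rule ideal_of_insertE) auto
    have s: "s \<in> ideal_of J g"
      using cs(2) ideal_of_cong[of "- {i}" "g(i := b)" g] True by simp
    have eq: "Q * g i ^ N = c * (Q * b) + Q * s" unfolding cs(1) by (simp add: algebra_simps)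
    have "Q * g i ^ N \<in> ideal_of J g" unfolding eq
      by (intro ideal_of_closed(2) ideal_of_closed(3) less(4) s)
    then show ?thesis
    proof (induction N)
      case (Suc N)
      have "Q * g i ^ N \<in> ideal_of J g"
      proof (rule regD[OF less(2)])
        show "homogeneous (t + N * e) (Q * g i ^ N)"
          by (rule homogeneous_mult[OF less(3) homogeneous_power[OF g]])
        show "Q * g i ^ N * g i \<in> ideal_of J g" using Suc.prems by (simp add: mult_ac)
      qed
      then show ?case by (rule Suc.IH)
    qed simp
  next
    case False
    then obtain k where k: "k \<notin> J" "k \<noteq> i" using less(2) by blast
    have small: "card (- insert k J) < card (- J)" by (rule psubset_card_mono) (use k in auto)
    note IH = less(1)[OF small]
    have "Q \<in> ideal_of J g" if "homogeneous t Q" "Q * b \<in> ideal_of J g" for t Q using that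
    proof (induction t arbitrary: Q rule: less_induct)
      case (less t)
      have "Q * b \<in> ideal_of (insert k J) g"
        using less(3) ideal_of_mono[of "insert k J" J g] by auto
      then have "Q \<in> ideal_of (insert k J) g" using IH[OF _ less(2)] k \<open>i \<notin> J\<close> by blast
      with g less(2) obtain c s where cs: "Q = c * g k + s" "s \<in> ideal_of J g"
        "e \<le> t \<Longrightarrow> homogeneous (t - e) c" "t < e \<Longrightarrow> c = 0"
        by (rule ideal_of_insertE) (use k in auto)
      have "c \<in> ideal_of J g"
      proof (cases "e \<le> t")
        case True
        have eq: "c * b * g k = Q * b - b * s" unfolding cs(1) by (simp add: algebra_simps)
        have "c * b * g k \<in> ideal_of J g" unfolding eq
          by (intro ideal_of_closed(6) less(3) ideal_of_closed(3)[OF cs(2)])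
        then have "c * b \<in> ideal_of J g"
          by (rule regD[OF k(1) homogeneous_mult[OF cs(3)[OF True] b]])
        then show ?thesis by (rule less(1)[OF _ cs(3)[OF True], rotated]) (use e True in simp)
      qed (use cs(4) ideal_of_closed(1) in simp)
      then show ?case unfolding cs(1) using cs(2) ideal_of_closed(2,4) by blast
    qed
    then show ?thesis using less(3,4) by blast
  qed
qed

text \<open>It remains to see that \<open>g\<^sub>k\<close> is a nonzerodivisor modulo \<open>b\<close> and \<open>(g\<^sub>j : j \<in> J0)\<close>. From
  \<open>P g\<^sub>k = Q b\<close> one gets \<open>Q = c g\<^sub>k\<close>, because \<open>b\<close> is a nonzerodivisor modulo \<open>g\<^sub>k\<close> and the other generators;
  cancelling \<open>g\<^sub>k\<close> leaves \<open>P = c b\<close>. All equations are modulo \<open>(g\<^sub>j : j \<in> J0)\<close>.\<close>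

theorem regular_family_exchange:
  fixes g :: "'n::finite \<Rightarrow> ('n, 'k::comm_ring_1) mpol"
  assumes reg: "regular_family g" and g: "\<And>j. homogeneous e (g j)" and e: "e \<ge> 1"
    and b: "homogeneous e b" and cvp: "contains_var_powers (ideal_of UNIV (g(i := b)))"
  shows "regular_family (g(i := b))"
  unfolding regular_family_def
proof (intro allI impI)
  fix J k t P
  let ?g = "g(i := b)"
  assume k: "k \<notin> J" and P: "homogeneous t P" and mem: "P * ?g k \<in> ideal_of J ?g"
  have regD: "Q \<in> ideal_of J g" if "k \<notin> J" "homogeneous t Q" "Q * g k \<in> ideal_of J g" for k J t Q
    using reg that unfolding regular_family_def by simp
  note nzd = exchange_nonzero_divisor[OF reg g e b cvp]
  have same: "ideal_of J ?g = ideal_of J g" if "i \<notin> J" for J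
    by (rule ideal_of_cong) (use that in auto)
  show "P \<in> ideal_of J ?g"
  proof (cases "i \<in> J")
    case False
    show ?thesis
    proof (cases "k = i")
      case True
      then show ?thesis using nzd[OF False P] mem same[OF False] by simp
    next
      case ki: False
      then show ?thesis using regD[OF k P] mem same[OF False] by simp
    qed
  next
    case True
    define J0 where "J0 = J - {i}"
    have J: "J = insert i J0" "i \<notin> J0" "k \<notin> J0" "k \<noteq> i" using True k J0_def by auto
    have g': "homogeneous e (?g j)" for j using g b by simp
    have Pg: "homogeneous (t + e) (P * ?g k)" by (rule homogeneous_mult[OF P g'])
    from g' Pg mem[unfolded J(1)] obtain Q s where Q: "P * ?g k = Q * ?g i + s"
      "s \<in> ideal_of J0 ?g" "e \<le> t + e \<Longrightarrow> homogeneous (t + e - e) Q"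
      by (rule ideal_of_insertE) (use J(2) in auto)
    have Qt: "homogeneous t Q" using Q(3) by simp
    have s: "s \<in> ideal_of J0 g" using Q(2) same[OF J(2)] by simp
    have eq: "Q * b = P * g k - s" using Q(1) J(4) by simp
    have up: "ideal_of J0 g \<subseteq> ideal_of (insert k J0) g" by (rule ideal_of_mono) auto
    have "Q * b \<in> ideal_of (insert k J0) g" unfolding eq
      using s up by (intro ideal_of_closed(6) ideal_of_closed(3) ideal_of_generator) auto
    then have "Q \<in> ideal_of (insert k J0) g" by (rule nzd[rotated 2]) (use J Qt in auto)
    with g Qt obtain c s' where c: "Q = c * g k + s'" "s' \<in> ideal_of J0 g"
      "e \<le> t \<Longrightarrow> homogeneous (t - e) c" "t < e \<Longrightarrow> c = 0"
      by (rule ideal_of_insertE) (use J in auto)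
    have "homogeneous t (c * b)"
    proof (cases "e \<le> t")
      case True
      then show ?thesis using homogeneous_mult[OF c(3)[OF True] b] by simp
    qed (use c(4) in simp)
    then have hom: "homogeneous t (P - c * b)" by (rule homogeneous_diff[OF P])
    have eq': "(P - c * b) * g k = s + b * s'" using eq unfolding c(1) by (simp add: algebra_simps)
    have "(P - c * b) * g k \<in> ideal_of J0 g" unfolding eq'
      by (intro ideal_of_closed(2) s ideal_of_closed(3)[OF c(2)])
    then have "P - c * b \<in> ideal_of J0 g" by (rule regD[OF J(3) hom])
    then have "P - c * b \<in> ideal_of J ?g"
      using same[OF J(2)] ideal_of_mono[of J J0 ?g] J(1) by auto
    moreover have "?g i \<in> ideal_of J ?g" using True by (intro ideal_of_generator) auto
    then have "c * b \<in> ideal_of J ?g" using ideal_of_closed(3) by simp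
    ultimately have "(P - c * b) + c * b \<in> ideal_of J ?g" by (rule ideal_of_closed(2))
    then show ?thesis by simp
  qed
qed

text \<open>Membership in a monomial ideal is decided monomial by monomial.\<close>

lemma ideal_of_var_powers:
  fixes p :: "('n::finite, 'k::comm_ring_1) mpol"
  shows "p \<in> ideal_of J (\<lambda>j. var j ^ e) \<longleftrightarrow> (\<forall>t. lookup p t \<noteq> 0 \<longrightarrow> (\<exists>j\<in>J. e \<le> lookup t j))"
proof
  assume "p \<in> ideal_of J (\<lambda>j. var j ^ e)"
  then obtain c where c: "p = (\<Sum>j\<in>J. c j * var j ^ e)" by (rule ideal_ofE)
  show "\<forall>t. lookup p t \<noteq> 0 \<longrightarrow> (\<exists>j\<in>J. e \<le> lookup t j)"
  proof (intro allI impI)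
    fix t assume "lookup p t \<noteq> 0"
    then have "(\<Sum>j\<in>J. lookup (c j * var j ^ e) t) \<noteq> 0" unfolding c by (simp add: lookup_sum)
    then obtain j where j: "j \<in> J" "lookup (c j * var j ^ e) t \<noteq> 0" by (rule sum.not_neutral_contains_not_neutral)
    then have "t \<in> Poly_Mapping.keys (c j * var j ^ e)" by (simp add: in_keys_iff)
    then obtain a b where ab: "t = a + b" "b \<in> Poly_Mapping.keys (var j ^ e :: ('n, 'k) mpol)"
      using keys_mult[of "c j" "var j ^ e"] by blast
    have "b = Poly_Mapping.single j e" using ab(2) by (simp add: var_power split: if_splits)
    then have "e \<le> lookup t j" unfolding ab(1) by (simp add: lookup_add)
    then show "\<exists>j\<in>J. e \<le> lookup t j" using j(1) by blast
  qed
next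
  assume h: "\<forall>t. lookup p t \<noteq> 0 \<longrightarrow> (\<exists>j\<in>J. e \<le> lookup t j)"
  have "monomial t (lookup p t) \<in> ideal_of J (\<lambda>j. var j ^ e)" if "t \<in> Poly_Mapping.keys p" for t
  proof -
    obtain j where j: "j \<in> J" "e \<le> lookup t j" using h \<open>t \<in> Poly_Mapping.keys p\<close> by (auto simp: in_keys_iff)
    have "var j ^ e \<in> ideal_of J (\<lambda>j. var j ^ e :: ('n, 'k) mpol)"
      using ideal_of_generator[of J j "\<lambda>j. var j ^ e"] j(1) by simp
    then show ?thesis unfolding monomial_eq_mult_var_power[OF j(2)] by (rule ideal_of_closed(3))
  qed
  then have "(\<Sum>t\<in>Poly_Mapping.keys p. monomial t (lookup p t)) \<in> ideal_of J (\<lambda>j. var j ^ e)"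
    by (rule is_ideal_sum[OF is_ideal_ideal_of])
  then show "p \<in> ideal_of J (\<lambda>j. var j ^ e)" unfolding mpol_sum_monoms[symmetric] .
qed

lemma regular_var_powers: "regular_family (\<lambda>j. var j ^ e :: ('n::finite, 'k::comm_ring_1) mpol)"
  unfolding regular_family_def
proof (intro allI impI)
  fix J :: "'n set" and i t and Q :: "('n, 'k) mpol"
  assume i: "i \<notin> J" and mem: "Q * var i ^ e \<in> ideal_of J (\<lambda>j. var j ^ e)"
  show "Q \<in> ideal_of J (\<lambda>j. var j ^ e)" unfolding ideal_of_var_powers
  proof (intro allI impI)
    fix t assume "lookup Q t \<noteq> 0"
    then have "lookup (Q * var i ^ e) (t + Poly_Mapping.single i e) \<noteq> 0"
      by (simp add: var_power lookup_mult_monomial)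
    then obtain j where j: "j \<in> J" "e \<le> lookup (t + Poly_Mapping.single i e) j"
      using mem unfolding ideal_of_var_powers by blast
    then have "e \<le> lookup t j" using i by (auto simp: lookup_add lookup_single when_def split: if_splits)
    then show "\<exists>j\<in>J. e \<le> lookup t j" using j(1) by blast
  qed
qed

section \<open>Points of projective space\<close>

text \<open>The closed points: homogeneous ideals that are maximal among those with nonempty zero set.
  Obtained from Zorn's lemma, they are prime and pairwise incomparable.\<close>

definition maximal_relevant :: "('n::finite, 'k::comm_ring_1) mpol set \<Rightarrow> bool" where
  "maximal_relevant P \<longleftrightarrow> is_ideal P \<and> homogeneous_ideal P \<and> \<not> contains_var_powers P \<and>
     (\<forall>Q. is_ideal Q \<longrightarrow> homogeneous_ideal Q \<longrightarrow> \<not> contains_var_powers Q \<longrightarrow> P \<subseteq> Q \<longrightarrow> Q = P)"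

lemma maximal_relevantD:
  assumes "maximal_relevant P"
  shows "is_ideal P" "homogeneous_ideal P" "\<not> contains_var_powers P"
    "\<And>Q. is_ideal Q \<Longrightarrow> homogeneous_ideal Q \<Longrightarrow> \<not> contains_var_powers Q \<Longrightarrow> P \<subseteq> Q \<Longrightarrow> Q = P"
  using assms unfolding maximal_relevant_def by simp_all

lemma ex_maximal_relevant:
  fixes I :: "('n::finite, 'k::comm_ring_1) mpol set"
  assumes I: "is_ideal I" "homogeneous_ideal I" "\<not> contains_var_powers I"
  obtains P where "maximal_relevant P" "I \<subseteq> P"
proof -
  define A where "A = {P. is_ideal P \<and> homogeneous_ideal P \<and> \<not> contains_var_powers P \<and> I \<subseteq> P}"
  have "A \<noteq> {}" using I unfolding A_def by blast
  moreover have "\<Union>C \<in> A" if C: "C \<noteq> {}" "subset.chain A C" for C :: "('n, 'k) mpol set set"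
  proof -
    have CA': "C \<subseteq> A" and lin: "\<And>Z Y. Z \<in> C \<Longrightarrow> Y \<in> C \<Longrightarrow> Z \<subseteq> Y \<or> Y \<subseteq> Z"
      using C(2) unfolding subset_chain_def by blast+
    note CA = subsetD[OF CA']
    have "is_ideal (\<Union>C)"
      unfolding is_ideal_def
    proof (intro conjI ballI allI)
      obtain Z where Z: "Z \<in> C" using C(1) by blast
      then show "0 \<in> \<Union>C" using CA[OF Z] is_idealD(1)[of Z] unfolding A_def by blast
      fix a assume a: "a \<in> \<Union>C"
      then obtain Z where Z: "Z \<in> C" "a \<in> Z" by blast
      have iX: "is_ideal Z" using CA[OF Z(1)] unfolding A_def by blast
      show "r * a \<in> \<Union>C" for r using is_idealD(3)[OF iX Z(2)] Z(1) by blast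
      fix b assume "b \<in> \<Union>C"
      then obtain Y where Y: "Y \<in> C" "b \<in> Y" by blast
      have iY: "is_ideal Y" using CA[OF Y(1)] unfolding A_def by blast
      have "Z \<subseteq> Y \<or> Y \<subseteq> Z" by (rule lin[OF Z(1) Y(1)])
      then show "a + b \<in> \<Union>C"
      proof
        assume "Z \<subseteq> Y"
        then have "a + b \<in> Y" using is_idealD(2)[OF iY] Z(2) Y(2) by blast
        then show ?thesis using Y(1) by blast
      next
        assume "Y \<subseteq> Z"
        then have "a + b \<in> Z" using is_idealD(2)[OF iX] Z(2) Y(2) by blast
        then show ?thesis using Z(1) by blast
      qed
    qed
    moreover have "homogeneous_ideal (\<Union>C)"
      using CA unfolding A_def homogeneous_ideal_def by blast
    moreover have "\<not> contains_var_powers (\<Union>C)"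
    proof
      assume "contains_var_powers (\<Union>C)"
      then obtain N where N: "\<And>j. var j ^ N j \<in> \<Union>C" unfolding contains_var_powers_def by metis
      let ?F = "range (\<lambda>j. var j ^ N j :: ('n, 'k) mpol)"
      have "finite ?F" "?F \<subseteq> \<Union>C" using N by auto
      then obtain Y where Y: "Y \<in> C" "?F \<subseteq> Y"
        using C by (metis finite_subset_Union_chain)
      then have "contains_var_powers Y" unfolding contains_var_powers_def by blast
      then show False using CA[OF Y(1)] unfolding A_def by blast
    qed
    moreover have "I \<subseteq> \<Union>C" using C(1) CA unfolding A_def by blast
    ultimately show ?thesis unfolding A_def by simp
  qed
  ultimately obtain P where P: "P \<in> A" "\<forall>Z\<in>A. P \<subseteq> Z \<longrightarrow> Z = P"
    using subset_Zorn_nonempty[of A] by blast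
  have PA: "is_ideal P" "homogeneous_ideal P" "\<not> contains_var_powers P" "I \<subseteq> P"
    using P(1) unfolding A_def by simp_all
  have "Q = P" if "is_ideal Q" "homogeneous_ideal Q" "\<not> contains_var_powers Q" "P \<subseteq> Q" for Q
  proof -
    have "Q \<in> A" using that PA(4) unfolding A_def by simp
    then show ?thesis using P(2) that(4) by simp
  qed
  then have "maximal_relevant P" unfolding maximal_relevant_def using PA by simp
  then show ?thesis using PA(4) that by blast
qed

lemma ideal_plus_element:
  fixes P :: "('n::finite, 'k::comm_ring_1) mpol set"
  assumes P: "is_ideal P" "homogeneous_ideal P" and a: "homogeneous s a"
  defines "Q \<equiv> {p + r * a | p r. p \<in> P}"
  shows "is_ideal Q" "homogeneous_ideal Q" "P \<subseteq> Q" "a \<in> Q"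
proof -
  have QI: "p + r * a \<in> Q" if "p \<in> P" for p r using that unfolding Q_def by blast
  show "is_ideal Q"
    unfolding is_ideal_def
  proof (intro conjI ballI allI)
    show "0 \<in> Q" using QI[OF is_idealD(1)[OF P(1)], of 0] by simp
    fix x assume "x \<in> Q"
    then obtain p r where x: "x = p + r * a" "p \<in> P" unfolding Q_def by blast
    have "u * x = u * p + (u * r) * a" for u unfolding x by (simp add: algebra_simps)
    then show "u * x \<in> Q" for u using QI[OF is_idealD(3)[OF P(1) x(2)]] by simp
    fix y assume "y \<in> Q"
    then obtain q v where y: "y = q + v * a" "q \<in> P" unfolding Q_def by blast
    have "x + y = (p + q) + (r + v) * a" unfolding x y by (simp add: algebra_simps)
    then show "x + y \<in> Q" using QI[OF is_idealD(2)[OF P(1) x(2) y(2)]] by simp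
  qed
  show "homogeneous_ideal Q"
    unfolding homogeneous_ideal_def
  proof (intro ballI allI)
    fix x t assume "x \<in> Q"
    then obtain p r where x: "x = p + r * a" "p \<in> P" unfolding Q_def by blast
    have p: "hom_component t p \<in> P" using P(2) x(2) unfolding homogeneous_ideal_def by blast
    show "hom_component t x \<in> Q"
      using QI[OF p, of "hom_component (t - s) r"] QI[OF p, of 0]
      unfolding x(1) hom_component_add hom_component_mult_homogeneous[OF a] by simp
  qed
  show "P \<subseteq> Q"
  proof
    fix p assume "p \<in> P"
    then show "p \<in> Q" using QI[of p 0] by simp
  qed
  show "a \<in> Q" using QI[OF is_idealD(1)[OF P(1)], of 1] by simp
qed

text \<open>If neither \<open>a\<close> nor \<open>b\<close> lies in \<open>P\<close>, then by maximality \<open>P + (a)\<close> and \<open>P + (b)\<close> contain powers of all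
  variables, hence so does \<open>P + (a b) = P\<close>.\<close>

lemma maximal_relevant_prime_homogeneous:
  fixes P :: "('n::finite, 'k::comm_ring_1) mpol set"
  assumes P: "maximal_relevant P" and a: "homogeneous s a" and b: "homogeneous t b" and ab: "a * b \<in> P"
  shows "a \<in> P \<or> b \<in> P"
proof (rule ccontr)
  assume n: "\<not> ?thesis"
  note P' = maximal_relevantD[OF P]
  have ex: "\<exists>N p r. var j ^ N = p + r * c \<and> p \<in> P" if c: "homogeneous u c" "c \<notin> P" for j c u
  proof -
    let ?Q = "{p + r * c | p r. p \<in> P}"
    note Q = ideal_plus_element[OF P'(1,2) c(1)]
    have "contains_var_powers ?Q"
    proof (rule ccontr)
      assume "\<not> contains_var_powers ?Q"
      then have "?Q = P" using P'(4)[OF Q(1,2) _ Q(3)] by simp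
      then show False using Q(4) c(2) by simp
    qed
    then show ?thesis unfolding contains_var_powers_def by blast
  qed
  have "\<exists>N. var j ^ N \<in> P" for j
  proof -
    obtain N p r where 1: "var j ^ N = p + r * a" "p \<in> P" using ex[OF a, of j] n by blast
    obtain M q v where 2: "var j ^ M = q + v * b" "q \<in> P" using ex[OF b, of j] n by blast
    have eq: "var j ^ (N + M) = p * (q + v * b) + (r * a) * q + (r * v) * (a * b)"
      unfolding power_add 1(1) 2(1) by (simp add: algebra_simps)
    have "var j ^ (N + M) \<in> P" unfolding eq
      by (intro is_idealD(2)[OF P'(1)] is_idealD(4)[OF P'(1) 1(2)]
          is_idealD(3)[OF P'(1) 2(2)] is_idealD(3)[OF P'(1) ab])
    then show ?thesis ..
  qed
  then show False using P'(3) unfolding contains_var_powers_def by blast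
qed

text \<open>Compare the highest components of \<open>a\<close> and \<open>b\<close> that do not lie in \<open>P\<close>.\<close>

lemma prime_if_homogeneous_prime:
  fixes P :: "('n::finite, 'k::comm_ring_1) mpol set"
  assumes P: "is_ideal P" "homogeneous_ideal P"
    and pr: "\<And>s t a b. homogeneous s a \<Longrightarrow> homogeneous t b \<Longrightarrow> a * b \<in> P \<Longrightarrow> a \<in> P \<or> b \<in> P"
    and ab: "a * b \<in> P"
  shows "a \<in> P \<or> b \<in> P"
proof (rule ccontr)
  assume n: "\<not> ?thesis"
  have top: "\<exists>s. hom_component s x \<notin> P \<and> (\<forall>i>s. hom_component i x \<in> P)" if x: "x \<notin> P" for x
  proof -
    have "{s. hom_component s x \<notin> P} \<subseteq> {s. hom_component s x \<noteq> 0}"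
      using is_idealD(1)[OF P(1)] by auto
    then have fin: "finite {s. hom_component s x \<notin> P}" by (rule finite_subset) (rule finite_hom_components)
    have ne: "{s. hom_component s x \<notin> P} \<noteq> {}" using hom_component_not_in_ideal[OF P(1) x] by simp
    show ?thesis
    proof (intro exI conjI allI impI)
      show "hom_component (Max {s. hom_component s x \<notin> P}) x \<notin> P" using Max_in[OF fin ne] by simp
      fix i assume "i > Max {s. hom_component s x \<notin> P}"
      then show "hom_component i x \<in> P" using Max_ge[OF fin, of i] by auto
    qed
  qed
  obtain s where s: "hom_component s a \<notin> P" "\<And>i. i > s \<Longrightarrow> hom_component i a \<in> P" using top n by blast
  obtain t where t: "hom_component t b \<notin> P" "\<And>i. i > t \<Longrightarrow> hom_component i b \<in> P" using top n by blast
  let ?f = "\<lambda>i. hom_component i a * hom_component (s + t - i) b"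
  have "hom_component (s + t) (a * b) = ?f s + (\<Sum>i\<in>{..s+t}-{s}. ?f i)"
    unfolding hom_component_mult by (rule sum.remove) auto
  then have eq: "hom_component s a * hom_component t b =
      hom_component (s + t) (a * b) - (\<Sum>i\<in>{..s+t}-{s}. ?f i)" by simp
  have "(\<Sum>i\<in>{..s+t}-{s}. ?f i) \<in> P"
  proof (rule is_ideal_sum[OF P(1)])
    fix i assume i: "i \<in> {..s+t}-{s}"
    show "?f i \<in> P"
    proof (cases "i > s")
      case True
      then show ?thesis by (rule is_idealD(4)[OF P(1) s(2)])
    next
      case False
      then have "s + t - i > t" using i by auto
      then show ?thesis by (rule is_idealD(3)[OF P(1) t(2)])
    qed
  qed
  moreover have "hom_component (s + t) (a * b) \<in> P" using P(2) ab unfolding homogeneous_ideal_def by blast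
  ultimately have "hom_component s a * hom_component t b \<in> P"
    unfolding eq by (intro is_idealD(6)[OF P(1)])
  then show False using pr[OF homogeneous_hom_component homogeneous_hom_component] s(1) t(1) by blast
qed

lemma maximal_relevant_prime:
  assumes "maximal_relevant P" "a * b \<in> P"
  shows "a \<in> P \<or> b \<in> P"
  using maximal_relevantD(1,2)[OF assms(1)] maximal_relevant_prime_homogeneous[OF assms(1)] assms(2)
  by (rule prime_if_homogeneous_prime)

lemma maximal_relevant_one: "maximal_relevant P \<Longrightarrow> 1 \<notin> P"
proof
  assume P: "maximal_relevant P" and "1 \<in> P"
  then have "contains_var_powers P" unfolding contains_var_powers_def by (metis power_0)
  then show False using maximal_relevantD(3)[OF P] by simp
qed

lemma maximal_relevant_power:
  assumes P: "maximal_relevant P" shows "a ^ k \<in> P \<Longrightarrow> a \<in> P"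
proof (induction k)
  case 0
  then show ?case using maximal_relevant_one[OF P] by simp
next
  case (Suc k)
  then have "a * a ^ k \<in> P" by simp
  from maximal_relevant_prime[OF P this] show ?case using Suc.IH by blast
qed

lemma maximal_relevant_var:
  assumes P: "maximal_relevant P" shows "\<exists>j. var j \<notin> P"
proof (rule ccontr)
  assume "\<not> ?thesis"
  then have "\<And>j. var j ^ 1 \<in> P" by simp
  then have "contains_var_powers P" unfolding contains_var_powers_def by blast
  then show False using maximal_relevantD(3)[OF P] by simp
qed

lemma homogeneous_ideal_ideal_of:
  fixes g :: "'i \<Rightarrow> ('n::finite, 'k::comm_ring_1) mpol"
  assumes g: "\<And>j. homogeneous e (g j)"
  shows "homogeneous_ideal (ideal_of J g)"
  unfolding homogeneous_ideal_def
proof (intro ballI allI)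
  fix p t assume "p \<in> ideal_of J g"
  then obtain c where c: "p = (\<Sum>j\<in>J. c j * g j)" by (rule ideal_ofE)
  show "hom_component t p \<in> ideal_of J g"
  proof (rule ideal_ofI)
    show "hom_component t p = (\<Sum>j\<in>J. (if e \<le> t then hom_component (t - e) (c j) else 0) * g j)"
      unfolding c hom_component_sum
      by (rule sum.cong) (simp_all add: hom_component_mult_homogeneous[OF g])
  qed
qed

section \<open>Replacing a form by a power of a general linear form\<close>

text \<open>Gaussian elimination of one coordinate \<open>m\<close> at a time.\<close>

lemma linear_dependence:
  fixes c :: "'p \<Rightarrow> 'm \<Rightarrow> 'k::field"
  assumes "finite M" "finite S" "card M < card S"
  shows "\<exists>a. (\<exists>x\<in>S. a x \<noteq> 0) \<and> (\<forall>m\<in>M. (\<Sum>x\<in>S. a x * c x m) = 0)"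
  using assms
proof (induction M arbitrary: S c rule: finite_induct)
  case empty
  then obtain x where "x \<in> S" by fastforce
  then show ?case by (intro exI[of _ "\<lambda>_. 1"]) auto
next
  case (insert m M)
  show ?case
  proof (cases "\<forall>x\<in>S. c x m = 0")
    case True
    have "card M < card S" using insert by simp
    from insert.IH[OF insert.prems(1) this, of c] show ?thesis using True by (auto intro: sum.neutral)
  next
    case False
    then obtain y where y: "y \<in> S" "c y m \<noteq> 0" by blast
    let ?c = "\<lambda>x l. c x l - c x m / c y m * c y l"
    have "card M < card (S - {y})" using insert y by simp
    then obtain a where a: "\<exists>x\<in>S-{y}. a x \<noteq> 0" "\<And>l. l \<in> M \<Longrightarrow> (\<Sum>x\<in>S-{y}. a x * ?c x l) = 0"
      using insert.IH[of "S - {y}" ?c] insert.prems(1) by blast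
    let ?s = "\<Sum>x\<in>S-{y}. a x * (c x m / c y m)"
    let ?b = "\<lambda>x. if x = y then - ?s else a x"
    have eq: "(\<Sum>x\<in>S. ?b x * c x l) = (\<Sum>x\<in>S-{y}. a x * ?c x l)" for l
    proof -
      have "(\<Sum>x\<in>S. ?b x * c x l) = ?b y * c y l + (\<Sum>x\<in>S-{y}. ?b x * c x l)"
        by (rule sum.remove[OF insert.prems(1) y(1)])
      also have "(\<Sum>x\<in>S-{y}. ?b x * c x l) = (\<Sum>x\<in>S-{y}. a x * c x l)" by (rule sum.cong) auto
      also have "?b y * c y l = - (\<Sum>x\<in>S-{y}. a x * (c x m / c y m) * c y l)"
        by (simp add: sum_distrib_right)
      finally show ?thesis by (simp add: right_diff_distrib sum_subtractf mult.assoc)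
    qed
    have z: "(\<Sum>x\<in>S. ?b x * c x l) = 0" if "l \<in> insert m M" for l
    proof (cases "l = m")
      case True
      show ?thesis unfolding eq True using y(2) by (intro sum.neutral) simp
    next
      case False
      then show ?thesis unfolding eq using a(2) that by blast
    qed
    have nz: "\<exists>x\<in>S. ?b x \<noteq> 0" using a(1) by auto
    show ?thesis by (rule exI[of _ ?b], rule conjI[OF nz], rule ballI, rule z)
  qed
qed

text \<open>A polynomial with infinitely many roots in a field vanishes, here modulo an ideal and at constants
  only. Dividing by \<open>X - c0\<close> lowers the degree, and differences of distinct constants are invertible.\<close>

lemma poly_values_in_ideal:
  fixes P :: "('n, 'k::field) mpol set" and q :: "('n, 'k) mpol poly"
  assumes P: "is_ideal P" and "infinite {c. poly q (monomial 0 c) \<in> P}"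
  shows "coeff q i \<in> P"
  using assms(2)
proof (induction "degree q" arbitrary: q i)
  case 0
  then obtain a where a: "q = [:a:]" by (metis degree_eq_zeroE)
  have "{c. poly q (monomial 0 c) \<in> P} \<noteq> {}" using 0(2) by (metis finite.emptyI)
  then have "a \<in> P" unfolding a by (simp split: if_splits)
  then show ?case unfolding a using is_idealD(1)[OF P] by (simp add: coeff_pCons split: nat.split)
next
  case (Suc n)
  have "{c. poly q (monomial 0 c) \<in> P} \<noteq> {}" using Suc(3) by (metis finite.emptyI)
  then obtain c0 where c0: "poly q (monomial 0 c0) \<in> P" by blast
  let ?r = "synthetic_div q (monomial 0 c0)"
  have q: "q = [:- monomial 0 c0, 1:] * ?r + [:poly q (monomial 0 c0):]"
    by (rule synthetic_div_correct'[symmetric])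
  have val: "poly ?r (monomial 0 c) \<in> P" if c: "poly q (monomial 0 c) \<in> P" "c \<noteq> c0" for c
  proof -
    have "poly q (monomial 0 c) = poly ([:- monomial 0 c0, 1:] * ?r + [:poly q (monomial 0 c0):]) (monomial 0 c)"
      by (rule arg_cong[OF q])
    also have "\<dots> = monomial 0 (c - c0) * poly ?r (monomial 0 c) + poly q (monomial 0 c0)"
      by (simp add: single_diff algebra_simps)
    finally have "monomial 0 (c - c0) * poly ?r (monomial 0 c) = poly q (monomial 0 c) - poly q (monomial 0 c0)"
      by simp
    then have "monomial 0 (c - c0) * poly ?r (monomial 0 c) \<in> P"
      using is_idealD(6)[OF P c(1) c0] by simp
    then show ?thesis by (rule ideal_cancel_const[OF P, rotated]) (use c(2) in simp)
  qed
  have "infinite ({c. poly q (monomial 0 c) \<in> P} - {c0})" using Suc(3) by simp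
  moreover have "{c. poly q (monomial 0 c) \<in> P} - {c0} \<subseteq> {c. poly ?r (monomial 0 c) \<in> P}"
    using val by blast
  ultimately have "infinite {c. poly ?r (monomial 0 c) \<in> P}" using finite_subset by blast
  moreover have "n = degree ?r" using Suc(2) by (simp add: degree_synthetic_div)
  ultimately have IH: "coeff ?r i \<in> P" for i using Suc(1) by blast
  have "coeff q i = coeff ([:- monomial 0 c0, 1:] * ?r + [:poly q (monomial 0 c0):]) i"
    by (rule arg_cong[OF q])
  also have "\<dots> = coeff (pCons 0 ?r) i - monomial 0 c0 * coeff ?r i + coeff [:poly q (monomial 0 c0):] i"
    by simp
  also have "\<dots> \<in> P"
  proof (intro is_idealD(2)[OF P] is_idealD(6)[OF P] is_idealD(3)[OF P IH])
    show "coeff (pCons 0 ?r) i \<in> P" using IH is_idealD(1)[OF P] by (simp add: coeff_pCons split: nat.split)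
    show "coeff [:poly q (monomial 0 c0):] i \<in> P"
      using c0 is_idealD(1)[OF P] by (simp add: coeff_pCons split: nat.split)
  qed
  finally show ?case .
qed

text \<open>Linear forms whose coefficient vectors lie on a moment curve: when \<open>h\<close> is injective, no proper
  subspace contains infinitely many of them.\<close>

definition moment_form :: "('n::finite \<Rightarrow> nat) \<Rightarrow> 'k::field \<Rightarrow> ('n, 'k) mpol" where
  "moment_form h c = (\<Sum>j\<in>UNIV. monomial 0 (c ^ h j) * var j)"

lemma homogeneous_moment_form: "homogeneous 1 (moment_form h c)"
  unfolding moment_form_def
  by (rule homogeneous_sum) (use homogeneous_mult[OF homogeneous_const homogeneous_var] in simp)

lemma finite_moment_forms_in_prime:
  fixes P :: "('n::finite, 'k::field) mpol set"
  assumes P: "maximal_relevant P" and h: "inj h"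
  shows "finite {c. moment_form h c \<in> P}"
proof (rule ccontr)
  assume inf: "infinite {c. moment_form h c \<in> P}"
  let ?q = "\<Sum>j\<in>UNIV. Polynomial.monom (var j) (h j) :: ('n, 'k) mpol poly"
  have pw: "(monomial 0 c :: ('n, 'k) mpol) ^ k = monomial 0 (c ^ k)" for c k
    by (induction k) (simp_all add: mult_single)
  have "poly ?q (monomial 0 c) = moment_form h c" for c
    by (simp add: moment_form_def poly_sum poly_monom pw mult.commute)
  then have "coeff ?q (h j) \<in> P" for j
    using poly_values_in_ideal[OF maximal_relevantD(1)[OF P], of ?q] inf by simp
  moreover have "coeff ?q (h j) = var j" for j
    using h by (simp add: coeff_sum coeff_monom inj_eq sum.delta')
  ultimately show False using maximal_relevant_var[OF P] by simp
qed

lemma finite_mon_degree: "finite {t :: 'n::finite \<Rightarrow>\<^sub>0 nat. mon_degree t = N}"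
proof (rule finite_imageD)
  have "lookup ` {t :: 'n \<Rightarrow>\<^sub>0 nat. mon_degree t = N} \<subseteq> PiE UNIV (\<lambda>_. {..N})"
  proof
    fix f assume "f \<in> lookup ` {t :: 'n \<Rightarrow>\<^sub>0 nat. mon_degree t = N}"
    then obtain t :: "'n \<Rightarrow>\<^sub>0 nat" where t: "f = lookup t" "mon_degree t = N" by blast
    have "lookup t j \<le> N" for j
      using member_le_sum[of j UNIV "lookup t"] t(2) by (simp add: mon_degree_def)
    then show "f \<in> PiE UNIV (\<lambda>_. {..N})" unfolding t(1) by (simp add: PiE_def)
  qed
  then show "finite (lookup ` {t :: 'n \<Rightarrow>\<^sub>0 nat. mon_degree t = N})"
    by (rule finite_subset) (simp add: finite_PiE)
  show "inj_on lookup {t :: 'n \<Rightarrow>\<^sub>0 nat. mon_degree t = N}"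
    by (rule inj_onI) (simp add: lookup_inject)
qed

lemma maximal_relevant_prod:
  assumes P: "maximal_relevant P"
  shows "finite S \<Longrightarrow> (\<And>x. x \<in> S \<Longrightarrow> a x \<notin> P) \<Longrightarrow> (\<Prod>x\<in>S. a x) \<notin> P"
proof (induction S rule: finite_induct)
  case empty
  then show ?case using maximal_relevant_one[OF P] by simp
next
  case (insert x S)
  have "(\<Prod>x\<in>S. a x) \<notin> P" using insert by simp
  moreover have "a x \<notin> P" using insert by simp
  ultimately show ?case using maximal_relevant_prime[OF P, of "a x" "\<Prod>x\<in>S. a x"] insert(1,2) by auto
qed

text \<open>Distinct points are incomparable, so for each \<open>Q \<noteq> P\<close> some form vanishes at \<open>Q\<close> but not at \<open>P\<close>; as
  \<open>P\<close> is prime, the product of these forms does not vanish at \<open>P\<close> either.\<close>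

lemma separating_form:
  fixes S :: "('n::finite, 'k::comm_ring_1) mpol set set"
  assumes S: "finite S" "\<And>P. P \<in> S \<Longrightarrow> maximal_relevant P" and P: "P \<in> S"
  shows "\<exists>t h. homogeneous t h \<and> h \<notin> P \<and> (\<forall>Q\<in>S-{P}. h \<in> Q)"
proof -
  have "\<exists>t a. homogeneous t a \<and> a \<in> Q \<and> a \<notin> P" if Q: "Q \<in> S - {P}" for Q
  proof -
    note mP = maximal_relevantD[OF S(2)[OF P]]
    have "maximal_relevant Q" using S(2) Q by simp
    note mQ = maximal_relevantD[OF this]
    have "\<not> Q \<subseteq> P" using mQ(4)[OF mP(1,2,3)] Q by auto
    then obtain x where x: "x \<in> Q" "x \<notin> P" by blast
    obtain s where s: "hom_component s x \<notin> P" using hom_component_not_in_ideal[OF mP(1) x(2)] ..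
    have "hom_component s x \<in> Q" using mQ(2) x(1) unfolding homogeneous_ideal_def by blast
    with s homogeneous_hom_component[of s x] show ?thesis by blast
  qed
  then obtain t a where ta: "\<And>Q. Q \<in> S - {P} \<Longrightarrow> homogeneous (t Q) (a Q)"
    "\<And>Q. Q \<in> S - {P} \<Longrightarrow> a Q \<in> Q" "\<And>Q. Q \<in> S - {P} \<Longrightarrow> a Q \<notin> P" by metis
  let ?h = "\<Prod>Q\<in>S-{P}. a Q"
  have "homogeneous (\<Sum>Q\<in>S-{P}. t Q) ?h" by (rule homogeneous_prod[OF ta(1)])
  moreover have "?h \<notin> P"
    by (rule maximal_relevant_prod[OF S(2)[OF P]]) (use S(1) ta(3) in auto)
  moreover have "?h \<in> Q" if Q: "Q \<in> S - {P}" for Q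
  proof -
    have "maximal_relevant Q" using S(2) Q by simp
    note mQ = maximal_relevantD(1)[OF this]
    have "?h = a Q * (\<Prod>Q\<in>S-{P}-{Q}. a Q)" by (rule prod.remove[OF _ Q]) (use S(1) in simp)
    then show ?thesis using is_idealD(4)[OF mQ ta(2)[OF Q]] by simp
  qed
  ultimately show ?thesis by blast
qed

text \<open>A form of degree at least \<open>N\<close> lies in the ideal of all generators, so modulo the others it is a
  multiple of \<open>g\<^sub>i\<close>. Repeating this with the cofactor leads down to degree \<open>N\<close>. In particular the
  Hilbert function of the quotient by the other generators is bounded.\<close>

lemma reduce_mod_other_generators:
  fixes g :: "'n::finite \<Rightarrow> ('n, 'k::comm_ring_1) mpol"
  assumes g: "\<And>j. homogeneous e (g j)"
    and N: "\<And>t p. N \<le> t \<Longrightarrow> homogeneous t p \<Longrightarrow> p \<in> ideal_of UNIV g" and e: "e \<ge> 1"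
  shows "homogeneous (N + k * e) p \<Longrightarrow> \<exists>c. homogeneous N c \<and> p - c * g i ^ k \<in> ideal_of (- {i}) g"
proof (induction k arbitrary: p)
  case 0
  then show ?case using ideal_of_closed(1) by (intro exI[of _ p]) simp
next
  case (Suc k)
  have U: "insert i (- {i}) = UNIV" by auto
  have "p \<in> ideal_of (insert i (- {i})) g" unfolding U by (rule N[OF _ Suc.prems]) simp
  with g Suc.prems obtain c s where c: "p = c * g i + s" "s \<in> ideal_of (- {i}) g"
    "e \<le> N + Suc k * e \<Longrightarrow> homogeneous (N + Suc k * e - e) c"
    by (rule ideal_of_insertE) auto
  have "homogeneous (N + k * e) c" using c(3) by (simp add: add.commute)
  from Suc.IH[OF this] obtain c' where c': "homogeneous N c'" "c - c' * g i ^ k \<in> ideal_of (- {i}) g"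
    by blast
  have eq: "p - c' * g i ^ Suc k = (c - c' * g i ^ k) * g i + s"
    unfolding c(1) by (simp add: algebra_simps)
  have "p - c' * g i ^ Suc k \<in> ideal_of (- {i}) g" unfolding eq
    by (intro ideal_of_closed(2) ideal_of_closed(4)[OF c'(2)] c(2))
  then show ?case using c'(1) by blast
qed

text \<open>The common zeros of all generators but one are finite in number. Separating forms for the points,
  brought to a common high degree, are linearly independent modulo the ideal; but in high degree the
  quotient by the ideal is spanned by the multiples \<open>c g\<^sub>i\<^sup>k\<close> with \<open>c\<close> of degree \<open>N\<close>.\<close>

lemma card_maximal_relevant_bounded:
  fixes g :: "'n::finite \<Rightarrow> ('n, 'k::field) mpol"
  assumes g: "\<And>j. homogeneous e (g j)"
    and N: "\<And>t p. N \<le> t \<Longrightarrow> homogeneous t p \<Longrightarrow> p \<in> ideal_of UNIV g" and e: "e \<ge> 1"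
    and S: "finite S" "\<And>P. P \<in> S \<Longrightarrow> maximal_relevant P" "\<And>P. P \<in> S \<Longrightarrow> ideal_of (- {i}) g \<subseteq> P"
  shows "card S \<le> card {t :: 'n \<Rightarrow>\<^sub>0 nat. mon_degree t = N}"
proof (rule ccontr)
  let ?M = "{t :: 'n \<Rightarrow>\<^sub>0 nat. mon_degree t = N}"
  assume "\<not> ?thesis"
  then have card: "card ?M < card S" by simp
  have "\<exists>t h. homogeneous t h \<and> h \<notin> P \<and> (\<forall>Q\<in>S-{P}. h \<in> Q)" if "P \<in> S" for P
    using separating_form[OF S(1,2) that] .
  then obtain t h where th: "\<And>P. P \<in> S \<Longrightarrow> homogeneous (t P) (h P)" "\<And>P. P \<in> S \<Longrightarrow> h P \<notin> P"
    "\<And>P Q. P \<in> S \<Longrightarrow> Q \<in> S - {P} \<Longrightarrow> h P \<in> Q" by metis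
  have "\<exists>j. var j \<notin> P" if "P \<in> S" for P using maximal_relevant_var[OF S(2)[OF that]] .
  then obtain v where v: "\<And>P. P \<in> S \<Longrightarrow> var (v P) \<notin> P" by metis
  define k where "k = (\<Sum>P\<in>S. t P)"
  define H where "H P = h P * var (v P) ^ (N + k * e - t P)" for P
  have H: "homogeneous (N + k * e) (H P)" if P: "P \<in> S" for P
  proof -
    have "t P \<le> k" unfolding k_def by (rule member_le_sum[OF P]) (use S(1) in auto)
    also have "\<dots> \<le> k * e" using e by simp
    finally have "t P + (N + k * e - t P) * 1 = N + k * e" by simp
    moreover have "homogeneous (t P + (N + k * e - t P) * 1) (H P)" unfolding H_def
      by (rule homogeneous_mult[OF th(1)[OF P] homogeneous_power[OF homogeneous_var]])
    ultimately show ?thesis by simp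
  qed
  \<comment> \<open>the forms \<open>H P\<close> have a common degree and still separate the points\<close>
  have HP: "H P \<notin> P" if P: "P \<in> S" for P
  proof
    assume "H P \<in> P"
    then have "h P \<in> P \<or> var (v P) ^ (N + k * e - t P) \<in> P"
      unfolding H_def by (rule maximal_relevant_prime[OF S(2)[OF P]])
    then show False using th(2)[OF P] v[OF P] maximal_relevant_power[OF S(2)[OF P]] by blast
  qed
  have HQ: "H P \<in> Q" if "P \<in> S" "Q \<in> S - {P}" for P Q
  proof -
    have "maximal_relevant Q" using S(2) that(2) by simp
    from maximal_relevantD(1)[OF this] show ?thesis
      unfolding H_def by (rule is_idealD(4)) (rule th(3)[OF that])
  qed
  have "\<exists>c. homogeneous N c \<and> H P - c * g i ^ k \<in> ideal_of (- {i}) g" if "P \<in> S" for P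
    using reduce_mod_other_generators[OF g N e H[OF that]] .
  then obtain c where c: "\<And>P. P \<in> S \<Longrightarrow> homogeneous N (c P)"
    "\<And>P. P \<in> S \<Longrightarrow> H P - c P * g i ^ k \<in> ideal_of (- {i}) g" by metis
  obtain a where a: "\<exists>P\<in>S. a P \<noteq> 0" "\<And>m. m \<in> ?M \<Longrightarrow> (\<Sum>P\<in>S. a P * lookup (c P) m) = 0"
    using linear_dependence[OF finite_mon_degree S(1) card, of "\<lambda>P. lookup (c P)"] by blast
  have lk: "lookup (monomial 0 x * p) m = x * lookup p m" for x :: 'k and p :: "('n, 'k) mpol" and m
    using lookup_mult_monomial[of p 0 x m] by (simp add: mult.commute)
  have z: "(\<Sum>P\<in>S. monomial 0 (a P) * c P) = 0"
  proof (rule poly_mapping_eqI)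
    fix m
    have "(\<Sum>P\<in>S. a P * lookup (c P) m) = 0"
    proof (cases "m \<in> ?M")
      case False
      have "lookup (c P) m = 0" if "P \<in> S" for P
        using c(1)[OF that] False unfolding homogeneous_iff by auto
      then show ?thesis by simp
    qed (rule a(2))
    then show "lookup (\<Sum>P\<in>S. monomial 0 (a P) * c P) m = lookup 0 m"
      by (simp add: lookup_sum lk)
  qed
  have "(\<Sum>P\<in>S. monomial 0 (a P) * (H P - c P * g i ^ k)) =
      (\<Sum>P\<in>S. monomial 0 (a P) * H P) - (\<Sum>P\<in>S. monomial 0 (a P) * c P) * g i ^ k"
    by (simp add: right_diff_distrib sum_subtractf sum_distrib_right mult.assoc)
  then have "(\<Sum>P\<in>S. monomial 0 (a P) * H P) = (\<Sum>P\<in>S. monomial 0 (a P) * (H P - c P * g i ^ k))"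
    unfolding z by simp
  also have "\<dots> \<in> ideal_of (- {i}) g"
    by (intro is_ideal_sum[OF is_ideal_ideal_of] ideal_of_closed(3) c(2))
  finally have sum: "(\<Sum>P\<in>S. monomial 0 (a P) * H P) \<in> ideal_of (- {i}) g" .
  obtain P where P: "P \<in> S" "a P \<noteq> 0" using a(1) by blast
  note iP = maximal_relevantD(1)[OF S(2)[OF P(1)]]
  have "(\<Sum>Q\<in>S. monomial 0 (a Q) * H Q) = monomial 0 (a P) * H P + (\<Sum>Q\<in>S-{P}. monomial 0 (a Q) * H Q)"
    by (rule sum.remove[OF S(1) P(1)])
  then have split: "monomial 0 (a P) * H P =
      (\<Sum>Q\<in>S. monomial 0 (a Q) * H Q) - (\<Sum>Q\<in>S-{P}. monomial 0 (a Q) * H Q)" by simp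
  have "(\<Sum>Q\<in>S-{P}. monomial 0 (a Q) * H Q) \<in> P"
    by (rule is_ideal_sum[OF iP], rule is_idealD(3)[OF iP], rule HQ) (use P(1) in auto)
  moreover have "(\<Sum>Q\<in>S. monomial 0 (a Q) * H Q) \<in> P" using sum S(3)[OF P(1)] by blast
  ultimately have "monomial 0 (a P) * H P \<in> P"
    unfolding split by (intro is_idealD(6)[OF iP])
  then have "H P \<in> P" by (rule ideal_cancel_const[OF iP P(2)])
  then show False using HP[OF P(1)] by simp
qed

text \<open>Each bad \<open>c\<close> yields a common zero of the other generators that lies on the hyperplane of \<open>c\<close>. There
  are finitely many such zeros, and each lies on finitely many of the hyperplanes.\<close>

lemma generic_form_keeps_contains_var_powers:
  fixes g :: "'n::finite \<Rightarrow> ('n, 'k::field) mpol"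
  assumes g: "\<And>j. homogeneous e (g j)" and e: "e \<ge> 1"
    and cvp: "contains_var_powers (ideal_of UNIV g)" and h: "inj h"
  shows "finite {c. \<not> contains_var_powers (ideal_of UNIV (g(i := moment_form h c ^ e)))}"
proof (rule ccontr)
  let ?B = "{c. \<not> contains_var_powers (ideal_of UNIV (g(i := moment_form h c ^ e)))}"
  assume inf: "infinite ?B"
  obtain N where N: "\<And>t p. N \<le> t \<Longrightarrow> homogeneous t p \<Longrightarrow> p \<in> ideal_of UNIV g"
    using contains_high_degrees[OF is_ideal_ideal_of cvp] by blast
  have "\<exists>P. maximal_relevant P \<and> ideal_of UNIV (g(i := moment_form h c ^ e)) \<subseteq> P" if c: "c \<in> ?B" for c
  proof -
    have "homogeneous e ((g(i := moment_form h c ^ e)) j)" for j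
      using g homogeneous_power[OF homogeneous_moment_form, of e h c] by simp
    then have "homogeneous_ideal (ideal_of UNIV (g(i := moment_form h c ^ e)))"
      by (rule homogeneous_ideal_ideal_of)
    from ex_maximal_relevant[OF is_ideal_ideal_of this] c show ?thesis by blast
  qed
  then obtain F where F: "\<And>c. c \<in> ?B \<Longrightarrow> maximal_relevant (F c)"
    "\<And>c. c \<in> ?B \<Longrightarrow> ideal_of UNIV (g(i := moment_form h c ^ e)) \<subseteq> F c" by metis
  have form: "moment_form h c \<in> F c" if c: "c \<in> ?B" for c
  proof -
    have "(g(i := moment_form h c ^ e)) i \<in> ideal_of UNIV (g(i := moment_form h c ^ e))"
      by (rule ideal_of_generator) auto
    then have "moment_form h c ^ e \<in> F c" using F(2)[OF c] by auto
    then show ?thesis by (rule maximal_relevant_power[OF F(1)[OF c]])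
  qed
  have sub: "ideal_of (- {i}) g \<subseteq> F c" if c: "c \<in> ?B" for c
  proof -
    have "ideal_of (- {i}) g = ideal_of (- {i}) (g(i := moment_form h c ^ e))"
      by (rule ideal_of_cong) auto
    also have "\<dots> \<subseteq> ideal_of UNIV (g(i := moment_form h c ^ e))" by (rule ideal_of_mono) auto
    finally show ?thesis using F(2)[OF c] by (rule order.trans)
  qed
  have "infinite (F ` ?B)"
  proof
    assume "finite (F ` ?B)"
    from inf_img_fin_domE'[OF this inf] obtain P where P: "P \<in> F ` ?B" "infinite (F -` {P} \<inter> ?B)" .
    from P(1) have "maximal_relevant P" by (rule imageE) (simp only: F(1))
    then have "finite {c. moment_form h c \<in> P}" using h by (rule finite_moment_forms_in_prime)
    moreover have "F -` {P} \<inter> ?B \<subseteq> {c. moment_form h c \<in> P}"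
    proof
      fix c assume "c \<in> F -` {P} \<inter> ?B"
      then have "c \<in> ?B" "F c = P" by simp_all
      then show "c \<in> {c. moment_form h c \<in> P}" using form[of c] by simp
    qed
    ultimately show False using P(2) finite_subset[of "F -` {P} \<inter> ?B"] by simp
  qed
  from infinite_arbitrarily_large[OF this, of "Suc (card {t :: 'n \<Rightarrow>\<^sub>0 nat. mon_degree t = N})"]
  obtain S where S: "finite S" "card S = Suc (card {t :: 'n \<Rightarrow>\<^sub>0 nat. mon_degree t = N})" "S \<subseteq> F ` ?B"
    by auto
  have "card S \<le> card {t :: 'n \<Rightarrow>\<^sub>0 nat. mon_degree t = N}"
  proof (rule card_maximal_relevant_bounded[OF g N e S(1)])
    fix P assume "P \<in> S"
    then have "P \<in> F ` ?B" using S(3) by (rule subsetD[rotated])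
    then obtain c where c: "P = F c" "c \<in> ?B" by (rule imageE)
    show "maximal_relevant P" unfolding c(1) by (rule F(1)[OF c(2)])
    show "ideal_of (- {i}) g \<subseteq> P" unfolding c(1) by (rule sub[OF c(2)])
  qed
  then show False using S(2) by simp
qed

text \<open>The members of the two families \<open>x\<^sub>j\<^sup>e\<close> and \<open>g\<close> are replaced one by one by the same powers of linear
  forms, each general enough for both families. Regularity is pushed forward along the first chain of
  exchanges and pulled back along the second, where every exchange is undone by another one. All
  members have the same degree \<open>e\<close> throughout, which is why powers of linear forms are used.\<close>

theorem regular_family_if_contains_var_powers:
  fixes g :: "'n::finite \<Rightarrow> ('n, 'k::field) mpol"
  assumes inf: "infinite (UNIV :: 'k set)"
    and g: "\<And>j. homogeneous e (g j)" and e: "e \<ge> 1"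
    and cvp: "contains_var_powers (ideal_of UNIV g)"
  shows "regular_family g"
proof -
  obtain h :: "'n \<Rightarrow> nat" where h: "inj h" using finite_imp_inj_to_nat_seg[OF finite[of "UNIV :: 'n set"]] by blast
  define y where "y j = (var j ^ e :: ('n, 'k) mpol)" for j
  have y: "homogeneous e (y j)" for j
    unfolding y_def using homogeneous_power[OF homogeneous_var, of e j] by simp
  have ycvp: "contains_var_powers (ideal_of UNIV y)"
    unfolding contains_var_powers_def
  proof
    fix j have "y j \<in> ideal_of UNIV y" by (rule ideal_of_generator) auto
    then show "\<exists>N. var j ^ N \<in> ideal_of UNIV y" unfolding y_def by blast
  qed
  have yreg: "regular_family y" unfolding y_def by (rule regular_var_powers)
  define mix where "mix T b p = (\<lambda>j. if j \<in> T then b j else p j)"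
    for T :: "'n set" and b p :: "'n \<Rightarrow> ('n, 'k) mpol"
  have mix_insert: "mix (insert i T) (b(i := x)) p = (mix T b p)(i := x)" if "i \<notin> T" for i T b p x
    unfolding mix_def using that by auto
  have "\<exists>b. (\<forall>j. homogeneous e (b j)) \<and> contains_var_powers (ideal_of UNIV (mix T b g)) \<and>
      contains_var_powers (ideal_of UNIV (mix T b y)) \<and> regular_family (mix T b y) \<and>
      (regular_family (mix T b g) \<longrightarrow> regular_family g)" for T
    using finite[of T]
  proof (induction T rule: finite_induct)
    case empty
    have "mix {} y p = p" for p unfolding mix_def by simp
    then show ?case using y cvp ycvp yreg by (intro exI[of _ y]) simp
  next
    case (insert i T)
    then obtain b where b: "\<And>j. homogeneous e (b j)" "contains_var_powers (ideal_of UNIV (mix T b g))"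
      "contains_var_powers (ideal_of UNIV (mix T b y))" "regular_family (mix T b y)"
      "regular_family (mix T b g) \<Longrightarrow> regular_family g" by blast
    have hg: "homogeneous e (mix T b g j)" and hy: "homogeneous e (mix T b y j)" for j
      unfolding mix_def using b(1) g y by simp_all
    let ?Bg = "{c. \<not> contains_var_powers (ideal_of UNIV ((mix T b g)(i := moment_form h c ^ e)))}"
    let ?By = "{c. \<not> contains_var_powers (ideal_of UNIV ((mix T b y)(i := moment_form h c ^ e)))}"
    have "finite (?Bg \<union> ?By)"
      using generic_form_keeps_contains_var_powers[OF hg e b(2) h]
        generic_form_keeps_contains_var_powers[OF hy e b(3) h] by blast
    then have "?Bg \<union> ?By \<noteq> UNIV" using inf by metis
    then obtain c where c: "c \<notin> ?Bg \<union> ?By" by blast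
    let ?x = "moment_form h c ^ e"
    let ?b = "b(i := ?x)"
    have hx: "homogeneous e ?x" using homogeneous_power[OF homogeneous_moment_form, of e h c] by simp
    have cg: "contains_var_powers (ideal_of UNIV ((mix T b g)(i := ?x)))"
      and cy: "contains_var_powers (ideal_of UNIV ((mix T b y)(i := ?x)))" using c by simp_all
    have ry: "regular_family ((mix T b y)(i := ?x))"
      by (rule regular_family_exchange[OF b(4) hy e hx cy])
    have rg: "regular_family g" if "regular_family ((mix T b g)(i := ?x))"
    proof -
      have hgx: "homogeneous e (((mix T b g)(i := ?x)) j)" for j using hg hx by simp
      have restore: "((mix T b g)(i := ?x))(i := mix T b g i) = mix T b g" by auto
      have "regular_family (((mix T b g)(i := ?x))(i := mix T b g i))"
        by (rule regular_family_exchange[OF that hgx e hg]) (simp only: restore b(2))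
      then show ?thesis unfolding restore by (rule b(5))
    qed
    have hb: "homogeneous e (?b j)" for j using b(1) hx by simp
    show ?case
    proof (intro exI conjI allI impI)
      show "homogeneous e (?b j)" for j by (rule hb)
      show "contains_var_powers (ideal_of UNIV (mix (insert i T) ?b g))"
        unfolding mix_insert[OF insert(2)] by (rule cg)
      show "contains_var_powers (ideal_of UNIV (mix (insert i T) ?b y))"
        unfolding mix_insert[OF insert(2)] by (rule cy)
      show "regular_family (mix (insert i T) ?b y)"
        unfolding mix_insert[OF insert(2)] by (rule ry)
      show "regular_family g" if "regular_family (mix (insert i T) ?b g)"
        using that unfolding mix_insert[OF insert(2)] by (rule rg)
    qed
  qed
  then obtain b where b: "regular_family (mix UNIV b y)"
    "regular_family (mix UNIV b g) \<longrightarrow> regular_family g" by blast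
  have "mix UNIV b p = b" for p unfolding mix_def by simp
  then show ?thesis using b by simp
qed

section \<open>Smooth forms\<close>

lemma prime_ideal_if:
  fixes P :: "'a::comm_ring_1 set"
  assumes P: "is_ideal P" and one: "1 \<notin> P" and pr: "\<And>a b. a * b \<in> P \<Longrightarrow> a \<in> P \<or> b \<in> P"
  shows "prime_ideal P"
proof -
  let ?R = "ring_of_type_algebra :: 'a ring"
  have R: "carrier ?R = UNIV" "monoid.mult ?R = (*)" "ring.add ?R = (+)"
    "ring.zero ?R = 0" "monoid.one ?R = 1"
    by (simp_all add: ring_of_type_algebra_def)
  interpret cring ?R by (rule cring_from_type_algebra)
  have inv: "m_inv (add_monoid ?R) x = - x" for x
    unfolding a_inv_def[symmetric] by (rule add.inv_equality) (simp_all add: R)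
  have "subgroup P (add_monoid ?R)"
  proof (rule subgroup.intro)
    show "inv\<^bsub>add_monoid ?R\<^esub> x \<in> P" if "x \<in> P" for x
      unfolding inv using that by (rule is_idealD(5)[OF P])
  qed (simp_all add: R is_idealD[OF P])
  then have "ideal P ?R"
    by (intro idealI ring_axioms) (simp_all add: R is_idealD[OF P])
  then show ?thesis unfolding prime_ideal_def
    by (rule primeidealI) (use one pr cring_axioms in \<open>auto simp: R\<close>)
qed

lemma contains_var_powers_mono:
  "contains_var_powers I \<Longrightarrow> I \<subseteq> J \<Longrightarrow> contains_var_powers J"
  unfolding contains_var_powers_def by (meson subsetD)

text \<open>Otherwise some point \<open>P\<close> contains all the partials, and by Euler's relation also \<open>f\<close>. It is a point
  of the hypersurface at which the Jacobian matrix vanishes.\<close>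

lemma smooth_imp_partials_contain_var_powers:
  fixes f :: "('n::finite, 'k::field) mpol"
  assumes smooth: "smooth_hypersurface f" and f: "homogeneous d f" and d: "of_nat d \<noteq> (0 :: 'k)"
  shows "contains_var_powers (ideal_of UNIV (\<lambda>j. pdiff j f))"
proof (rule ccontr)
  assume n: "\<not> ?thesis"
  have "homogeneous_ideal (ideal_of UNIV (\<lambda>j. pdiff j f))"
    by (rule homogeneous_ideal_ideal_of) (rule homogeneous_pdiff[OF f])
  from ex_maximal_relevant[OF is_ideal_ideal_of this n]
  obtain P where P: "maximal_relevant P" "ideal_of UNIV (\<lambda>j. pdiff j f) \<subseteq> P" .
  note iP = maximal_relevantD(1)[OF P(1)]
  have pd: "pdiff j f \<in> P" for j
    using P(2) ideal_of_generator[of UNIV j "\<lambda>j. pdiff j f"] by auto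
  have "(\<Sum>j\<in>UNIV. var j * pdiff j f) \<in> P" by (intro is_ideal_sum[OF iP] is_idealD(3)[OF iP pd])
  then have "monomial 0 (of_nat d) * f \<in> P" unfolding euler[OF f] by simp
  then have "f \<in> P" by (rule ideal_cancel_const[OF iP d])
  moreover have "prime_ideal P"
    by (rule prime_ideal_if[OF iP maximal_relevant_one[OF P(1)] maximal_relevant_prime[OF P(1)]])
  ultimately have "P \<in> Proj_hypersurface f"
    unfolding Proj_hypersurface_def
    using maximal_relevantD(2)[OF P(1)] maximal_relevant_var[OF P(1)] by simp
  then have rank: "rank_mod P {()} (jacobian (\<lambda>_. f)) = 1"
    using smooth unfolding smooth_hypersurface_def by blast
  have "\<not> rows_independent_mod P {()} (jacobian (\<lambda>_. f))"
  proof
    assume "rows_independent_mod P {()} (jacobian (\<lambda>_. f))"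
    from this[unfolded rows_independent_mod_def, rule_format, of "\<lambda>_. 1" "()"]
    have "1 \<in> P" using pd by (simp add: jacobian_def)
    then show False using maximal_relevant_one[OF P(1)] by simp
  qed
  then have "T = {}" if "T \<subseteq> {()}" "rows_independent_mod P T (jacobian (\<lambda>_. f))" for T
    using that by (cases "T = {()}") auto
  moreover have "rows_independent_mod P {} (jacobian (\<lambda>_. f))"
    unfolding rows_independent_mod_def by simp
  ultimately have "{T. T \<subseteq> {()} \<and> rows_independent_mod P T (jacobian (\<lambda>_. f))} = {{}}"
    by blast
  then show False using rank unfolding rank_mod_def by simp
qed

text \<open>A product of two forms of positive degree is singular where both vanish. If there were no such
  point, then \<open>a\<^sup>t, b\<^sup>s, \<dots>, b\<^sup>s\<close> would be a regular family; the exponents equalize the degrees. For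
  \<open>n \<ge> 3\<close> it contains \<open>b\<^sup>s\<close> twice, and \<open>b\<^sup>s\<close> would be a nonzerodivisor modulo itself.\<close>

lemma total_degree_zero_or:
  fixes a b :: "('n::{finite,linorder}, 'k::field) mpol"
  assumes n: "CARD('n) \<ge> 3" and inf: "infinite (UNIV :: 'k set)"
    and ab: "homogeneous d (a * b)" "a * b \<noteq> 0"
    and cvp: "contains_var_powers (ideal_of UNIV (\<lambda>j. pdiff j (a * b)))"
  shows "total_degree a = 0 \<or> total_degree b = 0"
proof (rule ccontr)
  assume neg: "\<not> ?thesis"
  define s where "s = total_degree a"
  define t where "t = total_degree b"
  have st: "s \<ge> 1" "t \<ge> 1" using neg unfolding s_def t_def by simp_all
  have a: "homogeneous s a" unfolding s_def by (rule homogeneous_factor[OF ab])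
  have b: "homogeneous t b" unfolding t_def
    by (rule homogeneous_factor[of d b a]) (use ab in \<open>simp_all add: mult.commute\<close>)
  \<comment> \<open>three distinct indices: one carries the power of \<open>a\<close>, two carry the power of \<open>b\<close>\<close>
  define j0 :: 'n where "j0 = undefined"
  have "UNIV \<noteq> {j0}"
  proof
    assume "UNIV = {j0}"
    then have "CARD('n) = card {j0}" by simp
    then show False using n by simp
  qed
  then obtain j1 where j1: "j1 \<noteq> j0" by blast
  have "UNIV \<noteq> {j0, j1}"
  proof
    assume "UNIV = {j0, j1}"
    then have "CARD('n) = card {j0, j1}" by simp
    then show False using n j1 by simp
  qed
  then obtain j2 where j2: "j2 \<noteq> j0" "j2 \<noteq> j1" by blast
  define g where "g j = (if j = j0 then a ^ t else b ^ s)" for j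
  have g: "homogeneous (s * t) (g j)" for j
    unfolding g_def using homogeneous_power[OF a, of t] homogeneous_power[OF b, of s]
    by (simp add: mult.commute)
  have e: "s * t \<ge> 1" using st by simp
  have "contains_var_powers (ideal_of UNIV g)"
  proof (rule ccontr)
    assume "\<not> ?thesis"
    from ex_maximal_relevant[OF is_ideal_ideal_of homogeneous_ideal_ideal_of[OF g] this]
    obtain P where P: "maximal_relevant P" "ideal_of UNIV g \<subseteq> P" .
    note iP = maximal_relevantD(1)[OF P(1)]
    have gP: "g j \<in> P" for j using P(2) ideal_of_generator[of UNIV j g] by auto
    have aP: "a \<in> P" using gP[of j0] unfolding g_def by (auto intro: maximal_relevant_power[OF P(1)])
    have bP: "b \<in> P" using gP[of j1] j1 unfolding g_def by (auto intro: maximal_relevant_power[OF P(1)])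
    have "pdiff j (a * b) \<in> P" for j
      unfolding pdiff_mult by (intro is_idealD(2)[OF iP] is_idealD(3)[OF iP bP] is_idealD(4)[OF iP aP])
    then have "ideal_of UNIV (\<lambda>j. pdiff j (a * b)) \<subseteq> P" by (rule ideal_of_least[OF iP])
    then show False using contains_var_powers_mono[OF cvp] maximal_relevantD(3)[OF P(1)] by blast
  qed
  from regular_family_if_contains_var_powers[OF inf g e this] have "regular_family g" .
  moreover have "1 * g j2 \<in> ideal_of {j1} g"
    using ideal_of_generator[of "{j1}" j1 g] j1 j2 unfolding g_def by simp
  ultimately have "1 \<in> ideal_of {j1} g"
    using j2 homogeneous_one unfolding regular_family_def by (metis singletonD)
  from low_degree_in_ideal_eq_0[OF g homogeneous_one this] show False using e by simp
qed

text \<open>A coefficient of a syzygy lies in the ideal of the other members, where the lowest degree is \<open>e\<close>.\<close>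

lemma no_low_degree_syzygy:
  fixes g :: "'n::finite \<Rightarrow> ('n, 'k::comm_ring_1) mpol"
  assumes reg: "regular_family g" and g: "\<And>j. homogeneous e (g j)"
    and P: "\<And>j. homogeneous r (P j)" and syz: "(\<Sum>j\<in>UNIV. P j * g j) = 0" and "r < e"
  shows "P i = 0"
proof -
  have "(\<Sum>j\<in>UNIV. P j * g j) = P i * g i + (\<Sum>j\<in>UNIV-{i}. P j * g j)"
    by (rule sum.remove) auto
  then have "P i * g i = (\<Sum>j\<in>UNIV-{i}. - P j * g j)"
    using syz by (simp add: sum_negf eq_neg_iff_add_eq_0)
  then have "P i * g i \<in> ideal_of (UNIV - {i}) g" by (rule ideal_ofI)
  moreover have "i \<notin> UNIV - {i}" by simp
  ultimately have "P i \<in> ideal_of (UNIV - {i}) g"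
    using reg P[of i] unfolding regular_family_def by blast
  from low_degree_in_ideal_eq_0[OF g P this \<open>r < e\<close>] show ?thesis .
qed

section \<open>Syzygies of the partials of a product\<close>

definition derivation :: "('n::finite \<Rightarrow> ('n, 'k::comm_ring_1) mpol) \<Rightarrow> ('n, 'k) mpol \<Rightarrow> ('n, 'k) mpol" where
  "derivation P p = (\<Sum>j\<in>UNIV. P j * pdiff j p)"

lemma derivation_mult: "derivation P (p * q) = derivation P p * q + p * derivation P q"
  unfolding derivation_def pdiff_mult
  by (simp add: distrib_left sum.distrib sum_distrib_left sum_distrib_right mult_ac)

lemma derivation_power: "derivation P (p ^ Suc k) = of_nat (Suc k) * p ^ k * derivation P p"
proof (induction k)
  case (Suc k)
  have "derivation P (p ^ Suc (Suc k)) = derivation P p * p ^ Suc k + p * derivation P (p ^ Suc k)"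
    by (simp only: power_Suc[of p "Suc k"] derivation_mult)
  also have "\<dots> = of_nat (Suc (Suc k)) * p ^ Suc k * derivation P p"
    unfolding Suc.IH by (simp add: algebra_simps)
  finally show ?case .
qed simp

lemma of_nat_mpol_neq_0:
  "of_nat k \<noteq> (0 :: 'k::comm_ring_1) \<Longrightarrow> of_nat k \<noteq> (0 :: ('n, 'k) mpol)"
  using lookup_single_eq[of 0 "of_nat k :: 'k"] by (metis lookup_zero single_of_nat)

lemma prime_dvd_prod:
  fixes f :: "'a::comm_ring_1"
  assumes "\<And>a b. f dvd a * b \<Longrightarrow> f dvd a \<or> f dvd b" and "\<not> f dvd 1"
  shows "finite S \<Longrightarrow> f dvd (\<Prod>x\<in>S. a x) \<Longrightarrow> \<exists>x\<in>S. f dvd a x"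
proof (induction S rule: finite_induct)
  case (insert x S)
  then have "f dvd a x * (\<Prod>x\<in>S. a x)" by simp
  from assms(1)[OF this] show ?case using insert.IH by blast
qed (use assms(2) in simp)

text \<open>The argument sketched at the beginning. The set \<open>S\<close> below collects the factors divisible by the
  chosen form \<open>f\<^sub>i\<close>. As its degree is maximal, they are constant multiples of it, whence
  \<open>F = f\<^sub>i\<^sup>k C\<close> with \<open>k\<close> the size of \<open>S\<close>, and \<open>k d\<^sub>i\<close> is the sum of the degrees over \<open>S\<close>.\<close>

lemma syzygy_degree_bound:
  fixes f :: "nat \<Rightarrow> ('n::{finite,linorder}, 'k::field) mpol"
  assumes n: "CARD('n) \<ge> 3" and inf: "infinite (UNIV :: 'k set)" and I: "finite I"
    and f: "\<And>j. j \<in> I \<Longrightarrow> form (d j) (f j)" and i: "i \<in> I" and max: "\<And>j. j \<in> I \<Longrightarrow> d j \<le> d i"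
    and di: "d i \<ge> 2" and smooth: "smooth_hypersurface (f i)"
    and char: "\<And>S. S \<subseteq> I \<Longrightarrow> S \<noteq> {} \<Longrightarrow> of_nat (\<Sum>j\<in>S. d j) \<noteq> (0 :: 'k)"
    and P: "\<And>j. homogeneous r (P j)" "derivation P (\<Prod>j\<in>I. f j) = 0" and r: "r < d i - 1"
  shows "P l = 0"
proof -
  let ?f = "f i"
  have hom: "homogeneous (d j) (f j)" "f j \<noteq> 0" if "j \<in> I" for j
    using f[OF that] unfolding form_def by simp_all
  note hf = hom[OF i]
  have dnz: "of_nat (d i) \<noteq> (0 :: 'k)" using char[of "{i}"] i by simp
  have cvp: "contains_var_powers (ideal_of UNIV (\<lambda>j. pdiff j ?f))"
    by (rule smooth_imp_partials_contain_var_powers[OF smooth hf(1) dnz])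
  have hp: "homogeneous (d i - 1) (pdiff j ?f)" for j by (rule homogeneous_pdiff[OF hf(1)])
  have reg: "regular_family (\<lambda>j. pdiff j ?f)"
    by (rule regular_family_if_contains_var_powers[OF inf hp _ cvp]) (use di in simp)
  have prime: "?f dvd a \<or> ?f dvd b" if "?f dvd a * b" for a b
  proof (rule irreducible_imp_prime[OF hf(2) _ that])
    fix a b assume ab: "?f = a * b"
    show "total_degree a = 0 \<or> total_degree b = 0"
      using n inf hf cvp unfolding ab by (rule total_degree_zero_or)
  qed
  have td: "total_degree (f j) = d j" if "j \<in> I" for j
    using homogeneous_total_degree[OF hom[OF that]] .
  have big: "total_degree p \<ge> d i" if dvd: "?f dvd p" "p \<noteq> 0" for p
  proof -
    obtain c where c: "p = ?f * c" using dvd(1) by (rule dvdE)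
    then have "c \<noteq> 0" using dvd(2) by auto
    then show ?thesis unfolding c using total_degree_mult[OF hf(2)] td[OF i] by simp
  qed
  have "total_degree (1 :: ('n, 'k) mpol) = 0" by (rule homogeneous_total_degree[OF homogeneous_one]) simp
  then have n1: "\<not> ?f dvd 1" using big[of 1] di by auto
  define S where "S = {j \<in> I. ?f dvd f j}"
  have SI: "S \<subseteq> I" "i \<in> S" "finite S" using i I unfolding S_def by auto
  have "\<exists>c. f j = ?f * c" if "j \<in> S" for j using that unfolding S_def dvd_def by blast
  then obtain c where c: "\<And>j. j \<in> S \<Longrightarrow> f j = ?f * c j" by metis
  have cS: "c j \<noteq> 0 \<and> total_degree (c j) = 0 \<and> d j = d i" if j: "j \<in> S" for j
  proof -
    have jI: "j \<in> I" using j SI by blast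
    have "c j \<noteq> 0" using c[OF j] hom(2)[OF jI] by auto
    moreover from this have "d j = d i + total_degree (c j)"
      using total_degree_mult[OF hf(2), of "c j"] c[OF j] td[OF jI] td[OF i] by simp
    ultimately show ?thesis using max[OF jI] by simp
  qed
  define k where "k = card S"
  define C where "C = (\<Prod>j\<in>S. c j) * (\<Prod>j\<in>I-S. f j)"
  have "(\<Prod>j\<in>I. f j) = (\<Prod>j\<in>I-S. f j) * (\<Prod>j\<in>S. f j)" by (rule prod.subset_diff[OF SI(1) I])
  also have "(\<Prod>j\<in>S. f j) = (\<Prod>j\<in>S. ?f * c j)" by (rule prod.cong) (simp_all add: c)
  also have "\<dots> = ?f ^ k * (\<Prod>j\<in>S. c j)" by (simp add: prod.distrib k_def)
  finally have F: "(\<Prod>j\<in>I. f j) = ?f ^ k * C" unfolding C_def by (simp add: mult_ac)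
  have nC: "\<not> ?f dvd C"
  proof
    assume "?f dvd C"
    then consider "?f dvd (\<Prod>j\<in>S. c j)" | "?f dvd (\<Prod>j\<in>I-S. f j)" unfolding C_def using prime by blast
    then show False
    proof cases
      case 1
      then obtain j where j: "j \<in> S" "?f dvd c j" using prime_dvd_prod[OF prime n1 SI(3)] by blast
      then show False using big[OF j(2)] cS[OF j(1)] di by simp
    next
      case 2
      have "finite (I - S)" using I by simp
      then obtain j where "j \<in> I - S" "?f dvd f j" using prime_dvd_prod[OF prime n1 _ 2] by blast
      then show False unfolding S_def by blast
    qed
  qed
  have "k \<noteq> 0" unfolding k_def using SI by auto
  then obtain k' where k': "k = Suc k'" by (cases k) auto
  have "(\<Sum>j\<in>S. d j) = k * d i" unfolding k_def using cS by simp
  then have "of_nat (k * d i) \<noteq> (0 :: 'k)" using char[OF SI(1)] SI(2) by auto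
  then have knz: "of_nat k \<noteq> (0 :: 'k)" by auto
  have "?f ^ k' * (of_nat k * derivation P ?f * C + ?f * derivation P C) = derivation P (?f ^ k * C)"
    unfolding k' derivation_mult derivation_power by (simp add: algebra_simps)
  also have "\<dots> = 0" using P(2) unfolding F .
  finally have "of_nat k * derivation P ?f * C + ?f * derivation P C = 0" using hf(2) by simp
  then have "(of_nat k * derivation P ?f) * C = ?f * (- derivation P C)"
    by (simp add: eq_neg_iff_add_eq_0)
  then have "?f dvd (of_nat k * derivation P ?f) * C" by (rule dvdI)
  then have "?f dvd of_nat k * derivation P ?f" using prime nC by blast
  then have "?f dvd monomial 0 (inverse (of_nat k)) * (of_nat k * derivation P ?f)" by (rule dvd_mult)
  moreover have "monomial 0 (inverse (of_nat k)) * (of_nat k :: ('n, 'k) mpol) = 1"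
    using knz by (simp add: single_of_nat[symmetric] mult_single del: single_of_nat)
  ultimately have "?f dvd derivation P ?f" by (simp add: mult.assoc[symmetric])
  then obtain q where q: "derivation P ?f = q * ?f" by (metis dvdE mult.commute)
  have ht: "homogeneous (r + (d i - 1)) (derivation P ?f)"
    unfolding derivation_def by (intro homogeneous_sum homogeneous_mult P(1) hp)
  \<comment> \<open>the cofactor \<open>q\<close> may be replaced by its component of degree \<open>r - 1\<close>; for \<open>r = 0\<close> by \<open>0\<close>\<close>
  define g where "g = (if d i \<le> r + (d i - 1) then hom_component (r + (d i - 1) - d i) q else 0)"
  have g: "derivation P ?f = g * ?f"
    using hom_component_homogeneous[OF ht, of "r + (d i - 1)"]
      hom_component_mult_homogeneous[OF hf(1), of "r + (d i - 1)" q]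
    unfolding q g_def by (simp split: if_splits)
  have gv: "homogeneous r (g * var j)" for j
  proof (cases "d i \<le> r + (d i - 1)")
    case True
    then have "homogeneous (r + (d i - 1) - d i + 1) (g * var j)"
      unfolding g_def by (simp only: if_True homogeneous_mult[OF homogeneous_hom_component homogeneous_var])
    moreover have "r + (d i - 1) - d i + 1 = r" using True di by simp
    ultimately show ?thesis by simp
  next
    case False
    then have "g = 0" unfolding g_def by (rule if_not_P)
    then show ?thesis by simp
  qed
  define W where "W j = of_nat (d i) * P j - g * var j" for j
  have W: "homogeneous r (W j)" for j
    unfolding W_def by (intro homogeneous_diff homogeneous_of_nat_mult P(1) gv)
  have comb: "(\<Sum>j\<in>UNIV. W j * pdiff j p) =
      of_nat (d i) * derivation P p - g * (\<Sum>j\<in>UNIV. var j * pdiff j p)" for p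
    unfolding W_def derivation_def
    by (simp add: left_diff_distrib sum_subtractf sum_distrib_left mult.assoc)
  have syz: "(\<Sum>j\<in>UNIV. W j * pdiff j ?f) = 0"
    unfolding comb euler[OF hf(1)] g by (simp add: mult_ac)
  have W0: "W j = 0" for j
    using reg hp W syz r by (rule no_low_degree_syzygy)
  have hF: "homogeneous (\<Sum>j\<in>I. d j) (\<Prod>j\<in>I. f j)" by (rule homogeneous_prod[OF hom(1)])
  have "g * (of_nat (\<Sum>j\<in>I. d j) * (\<Prod>j\<in>I. f j)) = 0"
    using comb[of "\<Prod>j\<in>I. f j"] unfolding euler[OF hF] P(2) by (simp add: W0)
  moreover have "of_nat (\<Sum>j\<in>I. d j) \<noteq> (0 :: ('n, 'k) mpol)"
    by (rule of_nat_mpol_neq_0) (use char[of I] i in blast)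
  moreover have "(\<Prod>j\<in>I. f j) \<noteq> 0" using hom(2) I by simp
  ultimately have "g = 0" by simp
  then have "of_nat (d i) * P l = 0" using W0[of l] unfolding W_def by simp
  then show ?thesis using of_nat_mpol_neq_0[OF dnz, where ?'n = 'n] by simp
qed

text \<open>For a form of maximal degree \<open>d\<^sub>i\<close> the bound \<open>r \<ge> d\<^sub>i - 1\<close> is at least the one claimed.\<close>

theorem proposition3p5:
  fixes f :: "nat \<Rightarrow> ('n::{finite,linorder}, 'k::field) mpol"
    and m :: nat
    and d :: "nat \<Rightarrow> nat"
  assumes "CARD('n) \<ge> 3"
    and "m \<ge> 2"
    and "infinite (UNIV :: 'k set)"
    and "\<forall>i\<in>{1..m}. d i \<ge> 2 \<and> form (d i) (f i)"
    and "nearly_transversal m f"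
    and "CHAR('k) = 0 \<or> (\<forall>S\<subseteq>{1..m}. S \<noteq> {} \<longrightarrow> \<not> CHAR('k) dvd (\<Sum>i\<in>S. d i))"
  shows "indeg (Syz_J (\<Prod>i=1..m. f i)) \<ge> enat (nat (\<lfloor>real (\<Sum>i=1..m. d i) / real m\<rfloor> - 1))"
proof -
  let ?I = "{1..m}"
  have "\<exists>i. i \<in> ?I \<and> (\<forall>j. j \<in> ?I \<longrightarrow> d j \<le> d i)"
    by (rule ex_has_greatest_nat[of _ 1 _ "Suc (\<Sum>j\<in>?I. d j)"])
      (use assms(2) member_le_sum[of _ ?I d] in \<open>auto simp: less_Suc_eq_le\<close>)
  then obtain i where i: "i \<in> ?I" "\<And>j. j \<in> ?I \<Longrightarrow> d j \<le> d i" by blast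
  have char: "of_nat (\<Sum>j\<in>S. d j) \<noteq> (0 :: 'k)" if S: "S \<subseteq> ?I" "S \<noteq> {}" for S
  proof -
    have "\<not> CHAR('k) dvd (\<Sum>j\<in>S. d j)"
    proof (cases "CHAR('k) = 0")
      case True
      obtain j where j: "j \<in> S" using S by blast
      have "finite S" using S(1) finite_subset by blast
      then have "d j \<le> (\<Sum>j\<in>S. d j)" using member_le_sum[OF j, of d] by simp
      moreover have "d j \<ge> 2" using assms(4) j S(1) by blast
      ultimately show ?thesis using True by simp
    next
      case False
      then have "\<forall>S\<subseteq>?I. S \<noteq> {} \<longrightarrow> \<not> CHAR('k) dvd (\<Sum>i\<in>S. d i)" using assms(6) by argo
      from this[rule_format, OF S] show ?thesis .
    qed
    then show ?thesis by (simp only: of_nat_eq_0_iff_char_dvd not_False_eq_True)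
  qed
  have floor: "nat (\<lfloor>real (\<Sum>i=1..m. d i) / real m\<rfloor> - 1) \<le> d i - 1"
  proof -
    have "(\<Sum>j\<in>?I. d j) \<le> (\<Sum>j\<in>?I. d i)" by (rule sum_mono) (rule i(2))
    then have "real (\<Sum>j\<in>?I. d j) \<le> real (m * d i)" by (simp only: of_nat_le_iff) simp
    then have "real (\<Sum>j\<in>?I. d j) / real m \<le> real (d i)" using assms(2) by (simp add: field_simps)
    then have "\<lfloor>real (\<Sum>j\<in>?I. d j) / real m\<rfloor> \<le> int (d i)" by linarith
    then show ?thesis by linarith
  qed
  have smooth: "smooth_hypersurface (f i)" using assms(5) i(1) unfolding nearly_transversal_def by blast
  have "enat (nat (\<lfloor>real (\<Sum>i=1..m. d i) / real m\<rfloor> - 1)) \<le> x"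
    if x: "x \<in> enat ` {r. \<exists>P\<in>Syz_J (\<Prod>i=1..m. f i). (\<exists>j. P j \<noteq> 0) \<and> (\<forall>j. homogeneous r (P j))}" for x
  proof -
    obtain r P where rP: "x = enat r" "P \<in> Syz_J (\<Prod>i=1..m. f i)" "\<exists>j. P j \<noteq> 0"
      "\<And>j. homogeneous r (P j)" using x by blast
    obtain l where l: "P l \<noteq> 0" using rP(3) by blast
    have der: "derivation P (\<Prod>i\<in>?I. f i) = 0" using rP(2) unfolding Syz_J_def derivation_def by simp
    have "\<not> r < d i - 1"
    proof
      assume r: "r < d i - 1"
      have "P l = 0"
        by (rule syzygy_degree_bound[OF assms(1,3) _ _ i(1) i(2) _ smooth char rP(4) der r])
          (use assms(4) i(1) in auto)
      then show False using l by simp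
    qed
    then show ?thesis using floor unfolding rP(1) by simp
  qed
  then show ?thesis unfolding indeg_def by (rule Inf_greatest)
qed

end
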